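(* The problem Terminal Monitoring Set (defined in the context) admits an FPT algorithm when parameterized by $k + q$, where $k$ is the solution-size bound of the instance and $q$ is the distance to cluster of the input graph $G$; i.e., it can be decided in time $f(k+q)\cdot |I|^{O(1)}$ for some computable function $f$, where $|I|$ is the size of the instance.
   Context: Terminal Monitoring Set (TMS): the input is $(G,\mathcal{T},k)$ where $G=(V,E)$ is a finite simple undirected graph, $\mathcal{T}=\{\{u_1,v_1\},\dots,\{u_l,v_l\}\}$ is a collection of pairs of vertices of $G$ (terminal pairs), and $k\in\mathbb{N}$. The question is whether there is a set $S\subseteq V$ with $|S|\le k$ such that for every $\{u,v\}\in\mathcal{T}$ there is $w\in S$ with $d(u,w)+d(w,v)=d(u,v)$, where $d$ denotes shortest-path distance in $G$ (i.e., $S$ contains a vertex on some shortest $u$–$v$ path). It is assumed that every terminal pair is at finite distance. A cluster graph is a disjoint union of complete graphs; the distance to cluster of $G$ is the minimum size of a set $X\subseteq V$ such that $G-X$ is a cluster graph. *)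

theory Defs
  imports Main "HOL-Library.Extended_Nat" "HOL-Library.Disjoint_Sets"
begin

text \<open>A graph is given by its vertex set \<open>V\<close> and its set \<open>E\<close> of two-element edges.\<close>

definition simple_graph :: "'a set \<Rightarrow> 'a set set \<Rightarrow> bool" where
  "simple_graph V E \<longleftrightarrow> finite V \<and> (\<forall>e\<in>E. e \<subseteq> V \<and> card e = 2)"

definition walk :: "'a set \<Rightarrow> 'a set set \<Rightarrow> 'a \<Rightarrow> 'a list \<Rightarrow> 'a \<Rightarrow> bool" where
  "walk V E u p v \<longleftrightarrow> p \<noteq> [] \<and> hd p = u \<and> last p = v \<and> set p \<subseteq> V
     \<and> successively (\<lambda>a b. {a, b} \<in> E) p"

text \<open>The infimum of the empty set is \<open>\<infinity>\<close>, the distance of disconnected vertices.\<close>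

definition gdist :: "'a set \<Rightarrow> 'a set set \<Rightarrow> 'a \<Rightarrow> 'a \<Rightarrow> enat" where
  "gdist V E u v = Inf {enat (length p - 1) | p. walk V E u p v}"

definition cluster_graph :: "'a set \<Rightarrow> 'a set set \<Rightarrow> bool" where
  "cluster_graph V E \<longleftrightarrow>
     (\<exists>P. partition_on V P \<and> E = {{u, v} | u v. u \<noteq> v \<and> (\<exists>C\<in>P. u \<in> C \<and> v \<in> C)})"

definition induced_edges :: "'a set set \<Rightarrow> 'a set \<Rightarrow> 'a set set" where
  "induced_edges E W = {e \<in> E. e \<subseteq> W}"

definition dist_to_cluster :: "'a set \<Rightarrow> 'a set set \<Rightarrow> nat" where
  "dist_to_cluster V E =
     (LEAST q. \<exists>X\<subseteq>V. card X = q \<and> cluster_graph (V - X) (induced_edges E (V - X)))"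

text \<open>Vertices are labelled by natural numbers so that instances can be written down as
  inputs of a program.\<close>

record tms =
  verts :: "nat set"
  edges :: "nat set set"
  terms :: "nat set set"
  bound :: nat

text \<open>A terminal pair \<open>{u, v}\<close> may have \<open>u = v\<close>.\<close>

definition tms_instances :: "tms set" where
  "tms_instances = {I. simple_graph (verts I) (edges I)
     \<and> terms I \<subseteq> {{u, v} | u v. u \<in> verts I \<and> v \<in> verts I}
     \<and> (\<forall>u v. {u, v} \<in> terms I \<longrightarrow> gdist (verts I) (edges I) u v \<noteq> \<infinity>)}"

definition tms_yes :: "tms \<Rightarrow> bool" where
  "tms_yes I \<longleftrightarrow> (\<exists>S \<subseteq> verts I. card S \<le> bound I \<and>
     (\<forall>u v. {u, v} \<in> terms I \<longrightarrow>
        (\<exists>w\<in>S. gdist (verts I) (edges I) u w + gdist (verts I) (edges I) w v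
              = gdist (verts I) (edges I) u v)))"

text \<open>
  The first-order functional language on binary trees of N. D. Jones (Computability and
  Complexity from a Programming Perspective, MIT Press 1997), with call-by-value semantics
  and unit cost for each evaluated subexpression. A program is a list of function bodies;
  every function takes one argument, and function 0 is the entry point. An implementation
  that represents trees by pointers into a heap with sharing performs each step with a
  bounded number of pointer operations (the only test is a test for \<open>NIL\<close>), so running
  time is polynomially related to that of Turing machines, even though a tree that is built
  with sharing can be exponentially larger than the number of steps.
\<close>

datatype sexp = NIL | CONS sexp sexp

datatype expr =
    ArgE
  | NilE
  | ConsE expr expr
  | HdE expr
  | TlE expr
  | IfE expr expr expr
  | CallE nat expr

type_synonym program = "expr list"

fun hd_sexp :: "sexp \<Rightarrow> sexp" where
  "hd_sexp NIL = NIL"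
| "hd_sexp (CONS a b) = a"

fun tl_sexp :: "sexp \<Rightarrow> sexp" where
  "tl_sexp NIL = NIL"
| "tl_sexp (CONS a b) = b"

text \<open>\<open>evaluates P x e v t\<close>: in program \<open>P\<close>, with \<open>x\<close> as the current argument, the
  expression \<open>e\<close> evaluates to \<open>v\<close> in \<open>t\<close> steps. A call of an undefined function is stuck.\<close>

inductive evaluates :: "program \<Rightarrow> sexp \<Rightarrow> expr \<Rightarrow> sexp \<Rightarrow> nat \<Rightarrow> bool" for P where
  Arg: "evaluates P x ArgE x 1"
| Nil: "evaluates P x NilE NIL 1"
| Cons: "evaluates P x e1 a s \<Longrightarrow> evaluates P x e2 b t \<Longrightarrow>
    evaluates P x (ConsE e1 e2) (CONS a b) (s + t + 1)"
| Hd: "evaluates P x e a t \<Longrightarrow> evaluates P x (HdE e) (hd_sexp a) (t + 1)"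
| Tl: "evaluates P x e a t \<Longrightarrow> evaluates P x (TlE e) (tl_sexp a) (t + 1)"
| IfTrue: "evaluates P x e a s \<Longrightarrow> a \<noteq> NIL \<Longrightarrow> evaluates P x e1 b t \<Longrightarrow>
    evaluates P x (IfE e e1 e2) b (s + t + 1)"
| IfFalse: "evaluates P x e NIL s \<Longrightarrow> evaluates P x e2 b t \<Longrightarrow>
    evaluates P x (IfE e e1 e2) b (s + t + 1)"
| Call: "evaluates P x e a s \<Longrightarrow> i < length P \<Longrightarrow> evaluates P a (P ! i) b t \<Longrightarrow>
    evaluates P x (CallE i e) b (s + t + 1)"

lemma evaluates_deterministic:
  "evaluates P x e v s \<Longrightarrow> evaluates P x e w t \<Longrightarrow> v = w \<and> s = t"
proof (induction arbitrary: w t rule: evaluates.induct)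
  case (Arg x)
  then show ?case by (auto elim: evaluates.cases)
next
  case (Nil x)
  then show ?case by (auto elim: evaluates.cases)
next
  case (Cons x e1 a s e2 b t)
  from Cons.prems Cons.IH show ?case by cases blast
next
  case (Hd x e a t)
  from Hd.prems Hd.IH show ?case by cases blast
next
  case (Tl x e a t)
  from Tl.prems Tl.IH show ?case by cases blast
next
  case (IfTrue x e a s e1 b t e2)
  from IfTrue.prems IfTrue.IH IfTrue.hyps show ?case by cases blast+
next
  case (IfFalse x e s e2 b t e1)
  from IfFalse.prems IfFalse.IH show ?case by cases blast+
next
  case (Call x e a s i b t)
  from Call.prems Call.IH show ?case by cases blast
qed

definition runs :: "program \<Rightarrow> sexp \<Rightarrow> sexp \<Rightarrow> nat \<Rightarrow> bool" where
  "runs P x v t \<longleftrightarrow> evaluates P x (CallE 0 ArgE) v t"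

fun sexp_size :: "sexp \<Rightarrow> nat" where
  "sexp_size NIL = 1"
| "sexp_size (CONS a b) = sexp_size a + sexp_size b + 1"

definition enc_bool :: "bool \<Rightarrow> sexp" where
  "enc_bool b = (if b then CONS NIL NIL else NIL)"

text \<open>Binary, least significant bit first, without leading zeros.\<close>

fun enc_nat :: "nat \<Rightarrow> sexp" where
  "enc_nat n = (if n = 0 then NIL else CONS (enc_bool (odd n)) (enc_nat (n div 2)))"

declare enc_nat.simps [simp del]

definition enc_pair :: "nat \<times> nat \<Rightarrow> sexp" where
  "enc_pair p = CONS (enc_nat (fst p)) (enc_nat (snd p))"

definition enc_list :: "('a \<Rightarrow> sexp) \<Rightarrow> 'a list \<Rightarrow> sexp" where
  "enc_list enc xs = foldr (\<lambda>x. CONS (enc x)) xs NIL"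

definition lists_set :: "'a list \<Rightarrow> 'a set \<Rightarrow> bool" where
  "lists_set xs A \<longleftrightarrow> distinct xs \<and> set xs = A"

text \<open>Vertices, edges and terminal pairs are listed without repetition; the order of the lists
  and the orientation of the pairs are arbitrary. All encodings of one instance have the same
  size.\<close>

definition tms_encodes :: "tms \<Rightarrow> sexp \<Rightarrow> bool" where
  "tms_encodes I x \<longleftrightarrow> (\<exists>vs es ts.
     lists_set vs (verts I) \<and>
     lists_set (map (\<lambda>(u, v). {u, v}) es) (edges I) \<and>
     lists_set (map (\<lambda>(u, v). {u, v}) ts) (terms I) \<and>
     x = CONS (enc_list enc_nat vs) (CONS (enc_list enc_pair es)
           (CONS (enc_list enc_pair ts) (enc_nat (bound I)))))"

definition computable :: "(nat \<Rightarrow> nat) \<Rightarrow> bool" where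
  "computable f \<longleftrightarrow> (\<exists>P. \<forall>n. \<exists>t. runs P (enc_nat n) (enc_nat (f n)) t)"

text \<open>\<open>fpt encodes A yes \<kappa>\<close>: the problem with instances \<open>A\<close>, given to the program in any form
  allowed by \<open>encodes\<close>, and yes-instances \<open>yes\<close> is fixed-parameter tractable in the
  parameter \<open>\<kappa>\<close>. The program is not given the value of \<open>\<kappa>\<close>. Constant factors of the
  polynomial are absorbed by \<open>f\<close>.\<close>

definition fpt ::
  "('i \<Rightarrow> sexp \<Rightarrow> bool) \<Rightarrow> 'i set \<Rightarrow> ('i \<Rightarrow> bool) \<Rightarrow> ('i \<Rightarrow> nat) \<Rightarrow> bool" where
  "fpt encodes A yes \<kappa> \<longleftrightarrow> (\<exists>P f c. computable f \<and>
     (\<forall>I\<in>A. \<forall>x. encodes I x \<longrightarrow>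
        (\<exists>t. runs P x (enc_bool (yes I)) t \<and> t \<le> f (\<kappa> I) * sexp_size x ^ c)))"

end

theory Submission imports Defs
begin

text \<open>
  Let \<open>X\<close> be the union of a maximal family of disjoint induced paths on three vertices. Each of
  them meets every cluster modulator, so \<open>|X| \<le> 3 q\<close>, and \<open>G - X\<close> is a cluster graph. A shortest
  path has at most two consecutive vertices outside \<open>X\<close>, so finite distances are at most
  \<open>3 |X| + 1\<close> and the vertices fall into at most \<open>(3 |X| + 3) ^ |X|\<close> profiles of distances to \<open>X\<close>.
  Whether a vertex \<open>w\<close> outside \<open>X\<close> lies on a shortest \<open>u\<close>-\<open>v\<close> path depends on the profile of \<open>w\<close>
  alone, unless \<open>w\<close> is in the clique of \<open>u\<close> or \<open>v\<close>; within a clique it depends on the profile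
  alone, unless \<open>w\<close> is \<open>u\<close> or \<open>v\<close>.

  A search tree therefore approximates each of the \<open>k\<close> solution vertices by a set of candidates:
  all vertices, a profile class, a profile class within a clique, or a single vertex. As long as a
  terminal pair is not hit by all candidates of some solution vertex, one of the sets has to be
  refined for the sake of this pair. There are boundedly many refinements, and at most \<open>3 k\<close> of
  them along a branch. The tree is explored level by level, so that the whole search is a loop
  around a polynomial-time function.

  Programs are obtained from closure properties of the functions that are computable in polynomial
  time with polynomially bounded output.
\<close>

section \<open>Programs\<close>

text \<open>Distances are cut off at \<open>3 * |X| + 2\<close>, one more than the bound on finite
  distances. The cut-off distance is a natural number, still obeys the triangle inequality and is
  exact on terminal pairs. Kept in unary, its sums are concatenations and its comparison is an
  equality of trees. Two features of the model shape the rest. The program does not know the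
  parameter: the modulator is found greedily, and the number of rounds comes from \<open>k\<close>,
  replaced by \<open>min k |V|\<close> because \<open>k\<close> is written in binary and may be
  huge. And since sharing makes trees of exponential size cheap, sizes of values are bounded
  separately from times. The search as a whole is not polynomial; only one round is, in the size of
  the instance together with the current frontier. If all frontiers have size at most
  \<open>R ^ 5\<close>, the total time is polynomial in \<open>R\<close>; this is used for
  \<open>R = W * (n + 1)\<close>, where \<open>W\<close> depends on the parameter alone and
  \<open>n\<close> is the size of the instance.\<close>

definition ev :: "program \<Rightarrow> sexp \<Rightarrow> expr \<Rightarrow> sexp \<Rightarrow> nat \<Rightarrow> bool" where
  "ev P x e v t \<longleftrightarrow> (\<exists>s\<le>t. evaluates P x e v s)"

lemma ev_mono: "ev P x e v s \<Longrightarrow> s \<le> t \<Longrightarrow> ev P x e v t"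
  unfolding ev_def using le_trans by blast

lemma ev_Arg: "ev P x ArgE x 1"
  and ev_Nil: "ev P x NilE NIL 1"
  unfolding ev_def by (blast intro: evaluates.intros)+

lemma ev_Cons: "ev P x e1 a s \<Longrightarrow> ev P x e2 b t \<Longrightarrow> ev P x (ConsE e1 e2) (CONS a b) (s + t + 1)"
  unfolding ev_def by (meson add_le_mono evaluates.Cons le_refl)

lemma ev_Hd: "ev P x e (CONS a b) t \<Longrightarrow> ev P x (HdE e) a (t + 1)"
  unfolding ev_def using evaluates.Hd[of P x e "CONS a b"] by fastforce

lemma ev_Tl: "ev P x e (CONS a b) t \<Longrightarrow> ev P x (TlE e) b (t + 1)"
  unfolding ev_def using evaluates.Tl[of P x e "CONS a b"] by fastforce

lemma ev_Tl': "ev P x e a t \<Longrightarrow> ev P x (TlE e) (tl_sexp a) (t + 1)"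
  unfolding ev_def using evaluates.Tl[of P x e a] by fastforce

lemma ev_IfTrue:
  "ev P x e a s \<Longrightarrow> a \<noteq> NIL \<Longrightarrow> ev P x e1 b t \<Longrightarrow> ev P x (IfE e e1 e2) b (s + t + 1)"
  unfolding ev_def by (meson add_le_mono evaluates.IfTrue le_refl)

lemma ev_IfFalse: "ev P x e NIL s \<Longrightarrow> ev P x e2 b t \<Longrightarrow> ev P x (IfE e e1 e2) b (s + t + 1)"
  unfolding ev_def by (meson add_le_mono evaluates.IfFalse le_refl)

lemma ev_Call:
  "ev P x e a s \<Longrightarrow> i < length P \<Longrightarrow> ev P a (P ! i) b t \<Longrightarrow> ev P x (CallE i e) b (s + t + 1)"
  unfolding ev_def by (meson add_le_mono evaluates.Call le_refl)

text \<open>Renumbers the calls of a body whose program is placed behind \<open>n\<close> other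
  functions.\<close>

primrec shift :: "nat \<Rightarrow> expr \<Rightarrow> expr" where
  "shift n ArgE = ArgE"
| "shift n NilE = NilE"
| "shift n (ConsE a b) = ConsE (shift n a) (shift n b)"
| "shift n (HdE a) = HdE (shift n a)"
| "shift n (TlE a) = TlE (shift n a)"
| "shift n (IfE a b c) = IfE (shift n a) (shift n b) (shift n c)"
| "shift n (CallE i a) = CallE (n + i) (shift n a)"

lemma evaluates_shift:
  "evaluates P x e v t \<Longrightarrow>
   evaluates (A @ map (shift (length A)) P @ B) x (shift (length A) e) v t"
proof (induction rule: evaluates.induct)
  case (Call x e a s i b t)
  have "(A @ map (shift (length A)) P @ B) ! (length A + i) = shift (length A) (P ! i)"
    using Call.hyps by (simp add: nth_append)
  then show ?case
    using Call evaluates.Call[of _ x "shift (length A) e" a s "length A + i" b t] by simp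
qed (auto intro: evaluates.intros[simplified])

text \<open>The new call adds nothing to \<open>s + t\<close>: the bound \<open>t\<close> already
  pays for the entry call of \<open>P\<close>, which costs two steps, and a direct call of the
  relocated body costs only one.\<close>

lemma ev_Call_shift:
  assumes Q: "Q = A @ map (shift (length A)) P @ B"
    and e: "ev Q x e y s" and P: "ev P y (CallE 0 ArgE) v t"
  shows "ev Q x (CallE (length A) e) v (s + t)"
proof -
  obtain t' where t': "t' \<le> t" "evaluates P y (CallE 0 ArgE) v t'"
    using P by (auto simp: ev_def)
  from t'(2) obtain r where r: "0 < length P" "evaluates P y (P ! 0) v r" "r + 2 \<le> t'"
    by cases (auto elim: evaluates.cases)
  have "ev Q y (Q ! length A) v r"
    using evaluates_shift[OF r(2), of A B] r(1) by (auto simp: ev_def Q nth_append)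
  then have "ev Q x (CallE (length A) e) v (s + r + 1)"
    using e r(1) by (intro ev_Call) (auto simp: Q)
  then show ?thesis
    by (rule ev_mono) (use r t' in simp)
qed

text \<open>The indices are fixed before \<open>e\<close> is chosen, because the new main body
  \<open>e\<close> has to mention them in its own calls.\<close>

lemma link_programs:
  obtains i1 i2 i3 where
    "\<And>e. \<exists>Q. Q \<noteq> [] \<and> Q ! 0 = e
      \<and> (\<forall>x a y v s t. ev Q x a y s \<longrightarrow> ev P1 y (CallE 0 ArgE) v t \<longrightarrow> ev Q x (CallE i1 a) v (s + t))
      \<and> (\<forall>x a y v s t. ev Q x a y s \<longrightarrow> ev P2 y (CallE 0 ArgE) v t \<longrightarrow> ev Q x (CallE i2 a) v (s + t))
      \<and> (\<forall>x a y v s t. ev Q x a y s \<longrightarrow> ev P3 y (CallE 0 ArgE) v t \<longrightarrow> ev Q x (CallE i3 a) v (s + t))"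
proof
  fix e
  define R1 where "R1 = map (shift 1) P1"
  define R2 where "R2 = map (shift (1 + length P1)) P2"
  define R3 where "R3 = map (shift (1 + length P1 + length P2)) P3"
  let ?Q = "e # R1 @ R2 @ R3"
  have 1: "?Q = [e] @ map (shift (length [e])) P1 @ (R2 @ R3)"
    and 2: "?Q = (e # R1) @ map (shift (length (e # R1))) P2 @ R3"
    and 3: "?Q = (e # R1 @ R2) @ map (shift (length (e # R1 @ R2))) P3 @ []"
    by (simp_all add: R1_def R2_def R3_def)
  show "\<exists>Q. Q \<noteq> [] \<and> Q ! 0 = e
      \<and> (\<forall>x a y v s t. ev Q x a y s \<longrightarrow> ev P1 y (CallE 0 ArgE) v t \<longrightarrow> ev Q x (CallE 1 a) v (s + t))
      \<and> (\<forall>x a y v s t. ev Q x a y s \<longrightarrow> ev P2 y (CallE 0 ArgE) v t \<longrightarrow>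
           ev Q x (CallE (1 + length P1) a) v (s + t))
      \<and> (\<forall>x a y v s t. ev Q x a y s \<longrightarrow> ev P3 y (CallE 0 ArgE) v t \<longrightarrow>
           ev Q x (CallE (1 + length P1 + length P2) a) v (s + t))"
    using ev_Call_shift[OF 1] ev_Call_shift[OF 2] ev_Call_shift[OF 3]
    by (intro exI[of _ ?Q]) (simp add: R1_def R2_def)
qed

section \<open>Encodable types\<close>

text \<open>Injectivity turns equality of values into equality of trees, which is what a program can
  test.\<close>

class encodable =
  fixes enc :: "'a \<Rightarrow> sexp"
  assumes enc_inject: "enc x = enc y \<Longrightarrow> x = y"

lemma enc_eq_iff [simp]: "enc x = enc y \<longleftrightarrow> x = y"
  using enc_inject by blast

instantiation unit :: encodable
begin
definition enc_unit :: "unit \<Rightarrow> sexp" where "enc_unit u = NIL"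
instance by standard simp
end

instantiation bool :: encodable
begin
definition enc_bool' [simp]: "enc = enc_bool"
instance by standard (auto simp: enc_bool_def split: if_splits)
end

lemma enc_nat_0 [simp]: "enc_nat 0 = NIL"
  by (simp add: enc_nat.simps)

lemma enc_nat_inject: "enc_nat m = enc_nat n \<Longrightarrow> m = n"
proof (induction m arbitrary: n rule: less_induct)
  case (less m)
  show ?case
  proof (cases "m = 0 \<or> n = 0")
    case True
    with less.prems show ?thesis by (auto simp: enc_nat.simps split: if_splits)
  next
    case False
    with less.prems have "enc_bool (odd m) = enc_bool (odd n)" "enc_nat (m div 2) = enc_nat (n div 2)"
      by (auto simp: enc_nat.simps[of m] enc_nat.simps[of n])
    then have "odd m = odd n" "m div 2 = n div 2"
      using less.IH[of "m div 2"] False by (auto simp: enc_bool_def split: if_splits)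
    then show ?thesis by (metis even_two_times_div_two odd_two_times_div_two_succ)
  qed
qed

instantiation nat :: encodable
begin
definition enc_nat' [simp]: "enc = enc_nat"
instance by standard (simp add: enc_nat_inject)
end

instantiation prod :: (encodable, encodable) encodable
begin
definition enc_prod :: "'a \<times> 'b \<Rightarrow> sexp" where
  "enc_prod p = CONS (enc (fst p)) (enc (snd p))"
instance by standard (auto simp: enc_prod_def prod_eq_iff)
end

lemma enc_Pair [simp]: "enc (a, b) = CONS (enc a) (enc b)"
  by (simp add: enc_prod_def)

lemma enc_list_simps [simp]:
  "enc_list f [] = NIL" "enc_list f (x # xs) = CONS (f x) (enc_list f xs)"
  by (simp_all add: enc_list_def)

instantiation list :: (encodable) encodable
begin
definition enc_list' : "enc = enc_list enc"
instance
proof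
  fix xs ys :: "'a list"
  show "enc xs = enc ys \<Longrightarrow> xs = ys"
    unfolding enc_list'
  proof (induction xs arbitrary: ys)
    case Nil then show ?case by (cases ys) auto
  next
    case (Cons x xs) then show ?case by (cases ys) auto
  qed
qed
end

lemma enc_simps [simp]:
  "enc () = NIL" "enc [] = NIL" "enc (x # xs) = CONS (enc x) (enc xs)"
  by (simp_all add: enc_list' enc_unit_def)

lemma enc_eq_NIL_iff [simp]: "enc xs = NIL \<longleftrightarrow> xs = []"
  by (cases xs) auto

definition sz :: "'a::encodable \<Rightarrow> nat" where
  "sz a = sexp_size (enc a)"

lemma sexp_size_pos: "sexp_size x > 0"
  by (cases x) auto

lemma sz_pos [simp]: "0 < sz a"
  by (simp add: sz_def sexp_size_pos)

lemma sz_simps [simp]: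
  "sz (a, b) = sz a + sz b + 1" "sz () = 1" "sz [] = 1" "sz (x # xs) = sz x + sz xs + 1"
  by (simp_all add: sz_def)

lemma sz_bool: "sz (b::bool) \<le> 3"
  by (simp add: sz_def enc_bool_def)

lemma sz_fst: "sz (fst p) < sz p" and sz_snd: "sz (snd p) < sz p"
  by (cases p; simp)+

lemma sz_append: "sz (xs @ ys) + 1 = sz xs + sz ys"
  by (induction xs) auto

lemma length_less_sz: "length xs < sz xs"
  by (induction xs) auto

lemma sz_mem: "x \<in> set xs \<Longrightarrow> sz x < sz xs"
  by (induction xs) auto

lemma sz_filter: "sz (filter P xs) \<le> sz xs"
  by (induction xs) auto

lemma sz_le_length: "(\<And>x. x \<in> set xs \<Longrightarrow> sz x \<le> B) \<Longrightarrow> sz xs \<le> 1 + length xs * (B + 1)"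
proof (induction xs)
  case (Cons x xs)
  have "sz x \<le> B" "sz xs \<le> 1 + length xs * (B + 1)" using Cons by auto
  then show ?case by simp
qed simp

section \<open>Running times of typed functions\<close>

definition rt :: "('a::encodable \<Rightarrow> 'b::encodable) \<Rightarrow> ('a \<Rightarrow> nat) \<Rightarrow> bool" where
  "rt F \<tau> \<longleftrightarrow> (\<exists>P. \<forall>a. ev P (enc a) (CallE 0 ArgE) (enc (F a)) (\<tau> a))"

lemma rt_mono: "rt F \<tau> \<Longrightarrow> (\<And>a. \<tau> a \<le> \<sigma> a) \<Longrightarrow> rt F \<sigma>"
  unfolding rt_def by (meson ev_mono)

lemma rt_coerce:
  fixes F :: "'a::encodable \<Rightarrow> 'b::encodable" and G :: "'a \<Rightarrow> 'c::encodable"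
  shows "rt F \<tau> \<Longrightarrow> (\<And>a. enc (F a) = enc (G a)) \<Longrightarrow> rt G \<tau>"
  unfolding rt_def by simp

lemma rt_body:
  assumes "\<And>a. ev [e] (enc a) e (enc (F a)) (\<tau> a)"
  shows "rt F (\<lambda>a. \<tau> a + 2)"
  unfolding rt_def
proof (intro exI[of _ "[e]"] allI)
  fix a
  show "ev [e] (enc a) (CallE 0 ArgE) (enc (F a)) (\<tau> a + 2)"
    by (rule ev_mono, rule ev_Call, rule ev_Arg) (use assms[of a] in auto)
qed

lemma rt_id: "rt (\<lambda>a. a) (\<lambda>_. 3)"
  using rt_body[of ArgE "\<lambda>a. a" "\<lambda>_. 1"] ev_Arg by (simp add: numeral_3_eq_3)

lemma rt_fst: "rt fst (\<lambda>_. 4)"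
proof -
  have "ev [HdE ArgE] (enc a) (HdE ArgE) (enc (fst a)) 2" for a :: "'a \<times> 'b"
    using ev_Hd[of "[HdE ArgE]" _ ArgE, OF ev_Arg[of _ "enc a", unfolded enc_prod_def]]
    by (simp add: enc_prod_def numeral_2_eq_2)
  from rt_body[OF this] show ?thesis by simp
qed

lemma rt_snd: "rt snd (\<lambda>_. 4)"
proof -
  have "ev [TlE ArgE] (enc a) (TlE ArgE) (enc (snd a)) 2" for a :: "'a \<times> 'b"
    using ev_Tl[of "[TlE ArgE]" _ ArgE, OF ev_Arg[of _ "enc a", unfolded enc_prod_def]]
    by (simp add: enc_prod_def numeral_2_eq_2)
  from rt_body[OF this] show ?thesis by simp
qed

lemma rt_tl: "rt (tl :: 'a::encodable list \<Rightarrow> _) (\<lambda>_. 4)"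
proof -
  have "ev [TlE ArgE] (enc a) (TlE ArgE) (enc (tl a)) 2" for a :: "'a list"
    using ev_Tl'[of "[TlE ArgE]" "enc a" ArgE, OF ev_Arg]
    by (cases a) (simp_all add: numeral_2_eq_2)
  from rt_body[OF this] show ?thesis by simp
qed

primrec quote :: "sexp \<Rightarrow> expr" where
  "quote NIL = NilE"
| "quote (CONS a b) = ConsE (quote a) (quote b)"

lemma ev_quote: "ev P x (quote v) v (sexp_size v)"
  by (induction v) (auto intro: ev_Nil[simplified] ev_Cons[simplified])

lemma rt_const: "rt (\<lambda>_. c) (\<lambda>_. sz c + 2)"
  by (rule rt_body[of "quote (enc c)" "\<lambda>_. c" "\<lambda>_. sz c"]) (simp add: sz_def ev_quote)

lemma rt_comp:
  assumes "rt F \<tau>" "rt G \<sigma>"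
  shows "rt (\<lambda>a. F (G a)) (\<lambda>a. \<sigma> a + \<tau> (G a) + 3)"
proof -
  obtain P1 where P1: "\<And>a. ev P1 (enc a) (CallE 0 ArgE) (enc (F a)) (\<tau> a)"
    using assms unfolding rt_def by blast
  obtain P2 where P2: "\<And>a. ev P2 (enc a) (CallE 0 ArgE) (enc (G a)) (\<sigma> a)"
    using assms unfolding rt_def by blast
  obtain i1 i2 i3 where L: "\<And>e. \<exists>Q. Q \<noteq> [] \<and> Q ! 0 = e
      \<and> (\<forall>x a y v s t. ev Q x a y s \<longrightarrow> ev P1 y (CallE 0 ArgE) v t \<longrightarrow> ev Q x (CallE i1 a) v (s + t))
      \<and> (\<forall>x a y v s t. ev Q x a y s \<longrightarrow> ev P2 y (CallE 0 ArgE) v t \<longrightarrow> ev Q x (CallE i2 a) v (s + t))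
      \<and> (\<forall>x a y v s t. ev Q x a y s \<longrightarrow> ev [] y (CallE 0 ArgE) v t \<longrightarrow> ev Q x (CallE i3 a) v (s + t))"
    by (rule link_programs[of P1 P2 "[]"]) blast
  from L[of "CallE i1 (CallE i2 ArgE)"] obtain Q where Q: "Q \<noteq> []" "Q ! 0 = CallE i1 (CallE i2 ArgE)"
    and c1: "\<And>x a y v s t. ev Q x a y s \<Longrightarrow> ev P1 y (CallE 0 ArgE) v t \<Longrightarrow> ev Q x (CallE i1 a) v (s + t)"
    and c2: "\<And>x a y v s t. ev Q x a y s \<Longrightarrow> ev P2 y (CallE 0 ArgE) v t \<Longrightarrow> ev Q x (CallE i2 a) v (s + t)"
    by blast
  have "ev Q (enc a) (CallE 0 ArgE) (enc (F (G a))) (\<sigma> a + \<tau> (G a) + 3)" for a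
  proof -
    have "ev Q (enc a) (CallE i1 (CallE i2 ArgE)) (enc (F (G a))) (1 + \<sigma> a + \<tau> (G a))"
      by (rule c1[OF c2[OF ev_Arg P2] P1])
    then have "ev Q (enc a) (CallE 0 ArgE) (enc (F (G a))) (1 + (1 + \<sigma> a + \<tau> (G a)) + 1)"
      using Q by (intro ev_Call[OF ev_Arg]) auto
    then show ?thesis by (rule ev_mono) simp
  qed
  then show ?thesis unfolding rt_def by blast
qed

lemma rt_pair:
  assumes "rt F \<tau>" "rt G \<sigma>"
  shows "rt (\<lambda>a. (F a, G a)) (\<lambda>a. \<tau> a + \<sigma> a + 5)"
proof -
  obtain P1 where P1: "\<And>a. ev P1 (enc a) (CallE 0 ArgE) (enc (F a)) (\<tau> a)"
    using assms unfolding rt_def by blast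
  obtain P2 where P2: "\<And>a. ev P2 (enc a) (CallE 0 ArgE) (enc (G a)) (\<sigma> a)"
    using assms unfolding rt_def by blast
  obtain i1 i2 i3 where L: "\<And>e. \<exists>Q. Q \<noteq> [] \<and> Q ! 0 = e
      \<and> (\<forall>x a y v s t. ev Q x a y s \<longrightarrow> ev P1 y (CallE 0 ArgE) v t \<longrightarrow> ev Q x (CallE i1 a) v (s + t))
      \<and> (\<forall>x a y v s t. ev Q x a y s \<longrightarrow> ev P2 y (CallE 0 ArgE) v t \<longrightarrow> ev Q x (CallE i2 a) v (s + t))
      \<and> (\<forall>x a y v s t. ev Q x a y s \<longrightarrow> ev [] y (CallE 0 ArgE) v t \<longrightarrow> ev Q x (CallE i3 a) v (s + t))"
    by (rule link_programs[of P1 P2 "[]"]) blast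
  let ?e = "ConsE (CallE i1 ArgE) (CallE i2 ArgE)"
  from L[of ?e] obtain Q where Q: "Q \<noteq> []" "Q ! 0 = ?e"
    and c1: "\<And>x a y v s t. ev Q x a y s \<Longrightarrow> ev P1 y (CallE 0 ArgE) v t \<Longrightarrow> ev Q x (CallE i1 a) v (s + t)"
    and c2: "\<And>x a y v s t. ev Q x a y s \<Longrightarrow> ev P2 y (CallE 0 ArgE) v t \<Longrightarrow> ev Q x (CallE i2 a) v (s + t)"
    by blast
  have "ev Q (enc a) (CallE 0 ArgE) (enc (F a, G a)) (\<tau> a + \<sigma> a + 5)" for a
  proof -
    have "ev Q (enc a) ?e (enc (F a, G a)) ((1 + \<tau> a) + (1 + \<sigma> a) + 1)"
      unfolding enc_Pair by (intro ev_Cons c1[OF ev_Arg P1] c2[OF ev_Arg P2])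
    then have "ev Q (enc a) (CallE 0 ArgE) (enc (F a, G a)) (1 + ((1 + \<tau> a) + (1 + \<sigma> a) + 1) + 1)"
      using Q by (intro ev_Call[OF ev_Arg]) auto
    then show ?thesis by (rule ev_mono) simp
  qed
  then show ?thesis unfolding rt_def by blast
qed

text \<open>One conditional serves both for tests of truth values and for case distinctions on
  lists: the result of the test is handed to the positive branch, and \<open>(a, x # xs)\<close> and
  \<open>(a, x, xs)\<close> have the same encoding.\<close>

lemma rt_branch:
  fixes C :: "'a::encodable \<Rightarrow> 'c::encodable" and F :: "'d::encodable \<Rightarrow> 'b::encodable"
  assumes "rt C \<tau>" "rt F \<sigma>" "rt G \<rho>"
    and m: "\<And>a. enc (C a) \<noteq> NIL \<Longrightarrow> enc (m a) = CONS (enc a) (enc (C a)) \<and> H a = F (m a)"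
    and n: "\<And>a. enc (C a) = NIL \<Longrightarrow> H a = G a"
  shows "rt H (\<lambda>a. 2 * \<tau> a + (if enc (C a) = NIL then \<rho> a else \<sigma> (m a)) + 8)"
proof -
  obtain P1 where P1: "\<And>a. ev P1 (enc a) (CallE 0 ArgE) (enc (C a)) (\<tau> a)"
    using assms unfolding rt_def by blast
  obtain P2 where P2: "\<And>a. ev P2 (enc a) (CallE 0 ArgE) (enc (F a)) (\<sigma> a)"
    using assms unfolding rt_def by blast
  obtain P3 where P3: "\<And>a. ev P3 (enc a) (CallE 0 ArgE) (enc (G a)) (\<rho> a)"
    using assms unfolding rt_def by blast
  obtain i1 i2 i3 where L: "\<And>e. \<exists>Q. Q \<noteq> [] \<and> Q ! 0 = e
      \<and> (\<forall>x a y v s t. ev Q x a y s \<longrightarrow> ev P1 y (CallE 0 ArgE) v t \<longrightarrow> ev Q x (CallE i1 a) v (s + t))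
      \<and> (\<forall>x a y v s t. ev Q x a y s \<longrightarrow> ev P2 y (CallE 0 ArgE) v t \<longrightarrow> ev Q x (CallE i2 a) v (s + t))
      \<and> (\<forall>x a y v s t. ev Q x a y s \<longrightarrow> ev P3 y (CallE 0 ArgE) v t \<longrightarrow> ev Q x (CallE i3 a) v (s + t))"
    by (rule link_programs[of P1 P2 P3]) blast
  let ?e = "IfE (CallE i1 ArgE) (CallE i2 (ConsE ArgE (CallE i1 ArgE))) (CallE i3 ArgE)"
  from L[of ?e] obtain Q where Q: "Q \<noteq> []" "Q ! 0 = ?e"
    and c1: "\<And>x a y v s t. ev Q x a y s \<Longrightarrow> ev P1 y (CallE 0 ArgE) v t \<Longrightarrow> ev Q x (CallE i1 a) v (s + t)"
    and c2: "\<And>x a y v s t. ev Q x a y s \<Longrightarrow> ev P2 y (CallE 0 ArgE) v t \<Longrightarrow> ev Q x (CallE i2 a) v (s + t)"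
    and c3: "\<And>x a y v s t. ev Q x a y s \<Longrightarrow> ev P3 y (CallE 0 ArgE) v t \<Longrightarrow> ev Q x (CallE i3 a) v (s + t)"
    by blast
  have "ev Q (enc a) (CallE 0 ArgE) (enc (H a))
      (2 * \<tau> a + (if enc (C a) = NIL then \<rho> a else \<sigma> (m a)) + 8)" for a
  proof -
    have t: "ev Q (enc a) (CallE i1 ArgE) (enc (C a)) (1 + \<tau> a)"
      by (rule c1[OF ev_Arg P1])
    have "ev Q (enc a) ?e (enc (H a))
      (2 * \<tau> a + (if enc (C a) = NIL then \<rho> a else \<sigma> (m a)) + 6)"
    proof (cases "enc (C a) = NIL")
      case True
      have "ev Q (enc a) ?e (enc (G a)) ((1 + \<tau> a) + (1 + \<rho> a) + 1)"
        by (rule ev_IfFalse[OF t[unfolded True] c3[OF ev_Arg P3]])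
      then show ?thesis
        by (rule ev_mono[OF back_subst[of "\<lambda>x. ev Q (enc a) ?e x _"]]) (use n True in auto)
    next
      case False
      have "ev Q (enc a) (ConsE ArgE (CallE i1 ArgE)) (enc (m a)) (1 + (1 + \<tau> a) + 1)"
        unfolding conjunct1[OF m[OF False]] by (rule ev_Cons[OF ev_Arg t])
      then have "ev Q (enc a) (CallE i2 (ConsE ArgE (CallE i1 ArgE))) (enc (F (m a)))
         ((1 + (1 + \<tau> a) + 1) + \<sigma> (m a))"
        by (rule c2[OF _ P2])
      then have "ev Q (enc a) ?e (enc (F (m a))) ((1 + \<tau> a) + ((1 + (1 + \<tau> a) + 1) + \<sigma> (m a)) + 1)"
        by (rule ev_IfTrue[OF t False])
      then show ?thesis
        by (rule ev_mono[OF back_subst[of "\<lambda>x. ev Q (enc a) ?e x _"]]) (use m False in auto)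
    qed
    then have "ev Q (enc a) (CallE 0 ArgE) (enc (H a))
      (1 + (2 * \<tau> a + (if enc (C a) = NIL then \<rho> a else \<sigma> (m a)) + 6) + 1)"
      using Q by (intro ev_Call[OF ev_Arg]) auto
    then show ?thesis by (rule ev_mono) simp
  qed
  then show ?thesis unfolding rt_def by blast
qed

text \<open>The accumulators are followed explicitly instead of being bounded in advance, so that
  the same rule serves both the polynomial loops and the exponentially growing search. The constant
  30 generously covers the overhead of one pass.\<close>

primrec fold_time :: "('s \<times> 'x \<Rightarrow> nat) \<Rightarrow> ('s \<Rightarrow> 'x \<Rightarrow> 's) \<Rightarrow> 's \<Rightarrow> 'x list \<Rightarrow> nat" where
  "fold_time \<sigma> f s [] = 30"
| "fold_time \<sigma> f s (x # xs) = \<sigma> (s, x) + 30 + fold_time \<sigma> f (f s x) xs"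

lemma fold_time_le:
  assumes "\<And>ys x zs. xs = ys @ x # zs \<Longrightarrow> \<sigma> (foldl f s ys, x) \<le> T"
  shows "fold_time \<sigma> f s xs \<le> (length xs + 1) * (T + 30)"
  using assms
proof (induction xs arbitrary: s)
  case (Cons x xs)
  have "\<sigma> (s, x) \<le> T" using Cons.prems[of "[]" x xs] by simp
  moreover have "fold_time \<sigma> f (f s x) xs \<le> (length xs + 1) * (T + 30)"
  proof (rule Cons.IH)
    fix ys y zs assume "xs = ys @ y # zs"
    then show "\<sigma> (foldl f (f s x) ys, y) \<le> T" using Cons.prems[of "x # ys" y zs] by simp
  qed
  ultimately show ?case by simp
qed simp

lemma rt_foldl:
  assumes "rt (\<lambda>p. f (fst p) (fst (snd p)) (snd (snd p))) \<sigma>"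
  shows "rt (\<lambda>p. foldl (f (fst p)) (fst (snd p)) (snd (snd p)))
    (\<lambda>p. fold_time (\<lambda>q. \<sigma> (fst p, q)) (f (fst p)) (fst (snd p)) (snd (snd p)))"
proof -
  obtain P where P: "\<And>p. ev P (enc p) (CallE 0 ArgE) (enc (f (fst p) (fst (snd p)) (snd (snd p)))) (\<sigma> p)"
    using assms unfolding rt_def by blast
  obtain i1 i2 i3 where L: "\<And>e. \<exists>Q. Q \<noteq> [] \<and> Q ! 0 = e
      \<and> (\<forall>x a y v s t. ev Q x a y s \<longrightarrow> ev P y (CallE 0 ArgE) v t \<longrightarrow> ev Q x (CallE i1 a) v (s + t))
      \<and> (\<forall>x a y v s t. ev Q x a y s \<longrightarrow> ev [] y (CallE 0 ArgE) v t \<longrightarrow> ev Q x (CallE i2 a) v (s + t))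
      \<and> (\<forall>x a y v s t. ev Q x a y s \<longrightarrow> ev [] y (CallE 0 ArgE) v t \<longrightarrow> ev Q x (CallE i3 a) v (s + t))"
    by (rule link_programs[of P "[]" "[]"]) blast
  let ?a = "HdE ArgE" and ?s = "HdE (TlE ArgE)" and ?xs = "TlE (TlE ArgE)"
  let ?e = "IfE ?xs (CallE 0 (ConsE ?a (ConsE (CallE i1 (ConsE ?a (ConsE ?s (HdE ?xs)))) (TlE ?xs)))) ?s"
  from L[of ?e] obtain Q where Q: "Q \<noteq> []" "Q ! 0 = ?e"
    and c1: "\<And>x a y v s t. ev Q x a y s \<Longrightarrow> ev P y (CallE 0 ArgE) v t \<Longrightarrow> ev Q x (CallE i1 a) v (s + t)"
    by blast
  \<comment> \<open>Each pass costs at most 25 beyond the body, so 5 units of the last 30 remain for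
    the entry call.\<close>
  have main: "ev Q (CONS (enc a) (CONS (enc s) (enc xs))) ?e (enc (foldl (f a) s xs))
      (fold_time (\<lambda>q. \<sigma> (a, q)) (f a) s xs - 5)" for a s xs
  proof (induction xs arbitrary: s)
    case Nil
    show ?case
      unfolding enc_simps foldl.simps
      by (rule ev_mono, rule ev_IfFalse, rule ev_Tl, rule ev_Tl, rule ev_Arg,
          rule ev_Hd, rule ev_Tl, rule ev_Arg) simp
  next
    case (Cons x xs)
    let ?A = "CONS (enc a) (CONS (enc s) (enc (x # xs)))"
    have a: "ev Q ?A ?a (enc a) 2"
      by (rule ev_mono, rule ev_Hd, rule ev_Arg) simp
    have s: "ev Q ?A ?s (enc s) 3"
      by (rule ev_mono, rule ev_Hd, rule ev_Tl, rule ev_Arg) simp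
    have xs: "ev Q ?A ?xs (enc (x # xs)) 3"
      by (rule ev_mono, rule ev_Tl, rule ev_Tl, rule ev_Arg) simp
    have "ev Q ?A (ConsE ?a (ConsE ?s (HdE ?xs))) (enc (a, s, x)) (2 + (3 + (3 + 1) + 1) + 1)"
      unfolding enc_Pair
      by (intro ev_Cons a s) (rule ev_Hd[of _ _ _ _ "enc xs"], use xs in simp)
    from c1[OF this P]
    have 1: "ev Q ?A (CallE i1 (ConsE ?a (ConsE ?s (HdE ?xs)))) (enc (f a s x)) (11 + \<sigma> (a, s, x))"
      by simp
    have 2: "ev Q ?A (TlE ?xs) (enc xs) (3 + 1)"
      by (rule ev_Tl[of _ _ _ "enc x"], use xs in simp)
    have ft: "30 \<le> fold_time (\<lambda>q. \<sigma> (a, q)) (f a) (f a s x) xs"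
      by (cases xs) auto
    show ?case
      apply (rule ev_mono)
       apply (rule ev_IfTrue[OF xs])
        apply simp
       apply (rule ev_Call)
         apply (rule ev_Cons[OF a])
         apply (rule ev_Cons[OF 1 2])
      using Q apply simp
      unfolding Q(2) foldl.simps
       apply (rule Cons.IH)
      using ft apply simp
      done
  qed
  have "ev Q (enc p) (CallE 0 ArgE) (enc (foldl (f (fst p)) (fst (snd p)) (snd (snd p))))
     (fold_time (\<lambda>q. \<sigma> (fst p, q)) (f (fst p)) (fst (snd p)) (snd (snd p)))" for p
  proof -
    obtain a s xs where p: "p = (a, s, xs)" by (cases p) auto
    have ft: "30 \<le> fold_time (\<lambda>q. \<sigma> (a, q)) (f a) s xs" by (cases xs) auto
    show ?thesis
      unfolding p fst_conv snd_conv enc_Pair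
      apply (rule ev_mono)
       apply (rule ev_Call[OF ev_Arg])
      using Q apply simp
      unfolding Q(2)
       apply (rule main)
      using ft by simp
  qed
  then show ?thesis unfolding rt_def by blast
qed

definition eq_expr :: expr where
  "eq_expr = (let A = HdE ArgE; B = TlE ArgE in
     IfE A (IfE B (IfE (CallE 0 (ConsE (HdE A) (HdE B)))
       (CallE 0 (ConsE (TlE A) (TlE B))) NilE) NilE) (IfE B NilE (ConsE NilE NilE)))"

text \<open>The recursion descends both trees in parallel and stops where either ends, so the size
  of the first tree alone pays for it.\<close>

lemma ev_eq:
  "ev [eq_expr] (CONS a b) eq_expr (enc_bool (a = b)) (40 * sexp_size a)"
proof (induction a arbitrary: b)
  case NIL
  have A: "ev [eq_expr] (CONS NIL b) (HdE ArgE) NIL 2" and B: "ev [eq_expr] (CONS NIL b) (TlE ArgE) b 2"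
    by (rule ev_mono, (rule ev_Hd ev_Tl), rule ev_Arg, simp)+
  show ?case
  proof (cases b)
    case NIL
    show ?thesis
      unfolding NIL enc_bool_def simp_thms if_True
      apply (rule ev_mono)
      apply (subst (2) eq_expr_def[unfolded Let_def])
      apply (rule ev_IfFalse[OF A[unfolded NIL]])
      apply (rule ev_IfFalse)
      apply (rule B[unfolded NIL])
      apply (rule ev_Cons[OF ev_Nil ev_Nil])
      by simp
  next
    case (CONS c d)
    then have b: "b \<noteq> NIL" by simp
    have f: "(NIL = b) = False" using b by simp
    show ?thesis
      apply (rule ev_mono)
      apply (subst (2) eq_expr_def[unfolded Let_def])
      apply (rule ev_IfFalse[OF A])
      apply (rule ev_IfTrue[OF B b])
      unfolding f enc_bool_def if_False
      apply (rule ev_Nil)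
      by simp
  qed
next
  case (CONS a1 a2)
  have A: "ev [eq_expr] (CONS (CONS a1 a2) b) (HdE ArgE) (CONS a1 a2) 2" and B: "ev [eq_expr] (CONS (CONS a1 a2) b) (TlE ArgE) b 2"
    by (rule ev_mono, (rule ev_Hd ev_Tl), rule ev_Arg, simp)+
  have n: "CONS a1 a2 \<noteq> NIL" by simp
  show ?case
  proof (cases b)
    case NIL
    have f: "(CONS a1 a2 = b) = False" using NIL by simp
    show ?thesis
      unfolding f enc_bool_def if_False
      apply (rule ev_mono)
      apply (subst (2) eq_expr_def[unfolded Let_def])
      apply (rule ev_IfTrue[OF A n])
      apply (rule ev_IfFalse)
      apply (use B NIL in simp)
      apply (rule ev_Nil)
      by simp
  next
    case b: (CONS b1 b2)
    have bn: "b \<noteq> NIL" using b by simp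
    let ?x = "CONS (CONS a1 a2) b"
    have h: "ev [eq_expr] ?x (CallE 0 (ConsE (HdE (HdE ArgE)) (HdE (TlE ArgE)))) (enc_bool (a1 = b1))
       (((2 + 1) + (2 + 1) + 1) + 40 * sexp_size a1 + 1)"
    proof (rule ev_Call)
      show "ev [eq_expr] ?x (ConsE (HdE (HdE ArgE)) (HdE (TlE ArgE))) (CONS a1 b1) ((2 + 1) + (2 + 1) + 1)"
        by (rule ev_Cons[OF ev_Hd[OF A] ev_Hd[of _ _ _ b1 b2]]) (use B b in simp)
    qed (use CONS.IH(1)[of b1] in auto)
    have t: "ev [eq_expr] ?x (CallE 0 (ConsE (TlE (HdE ArgE)) (TlE (TlE ArgE)))) (enc_bool (a2 = b2))
       (((2 + 1) + (2 + 1) + 1) + 40 * sexp_size a2 + 1)"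
    proof (rule ev_Call)
      show "ev [eq_expr] ?x (ConsE (TlE (HdE ArgE)) (TlE (TlE ArgE))) (CONS a2 b2) ((2 + 1) + (2 + 1) + 1)"
        by (rule ev_Cons[OF ev_Tl[OF A] ev_Tl[of _ _ _ b1 b2]]) (use B b in simp)
    qed (use CONS.IH(2)[of b2] in auto)
    show ?thesis
    proof (cases "a1 = b1")
      case True
      have h': "enc_bool (a1 = b1) \<noteq> NIL" using True by (simp add: enc_bool_def)
      have f: "(CONS a1 a2 = b) = (a2 = b2)" using b True by simp
      show ?thesis
        unfolding f
        apply (rule ev_mono)
        apply (subst (2) eq_expr_def[unfolded Let_def])
        apply (rule ev_IfTrue[OF A n])
        apply (rule ev_IfTrue[OF B bn])
        apply (rule ev_IfTrue[OF h h'])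
        apply (rule t)
        by simp
    next
      case False
      have h': "enc_bool (a1 = b1) = NIL" using False by (simp add: enc_bool_def)
      have f: "(CONS a1 a2 = b) = False" using b False by simp
      show ?thesis
        unfolding f enc_bool_def if_False
        apply (rule ev_mono)
        apply (subst (2) eq_expr_def[unfolded Let_def])
        apply (rule ev_IfTrue[OF A n])
        apply (rule ev_IfTrue[OF B bn])
        apply (rule ev_IfFalse[OF h[unfolded h']])
        apply (rule ev_Nil)
        by simp
    qed
  qed
qed

lemma rt_eq: "rt (\<lambda>p::'a::encodable \<times> 'a. fst p = snd p) (\<lambda>p. 40 * sz p + 2)"
proof (rule rt_body)
  fix p :: "'a \<times> 'a"
  show "ev [eq_expr] (enc p) eq_expr (enc (fst p = snd p)) (40 * sz p)"
    using ev_mono[OF ev_eq[of "enc (fst p)" "enc (snd p)"], of "40 * sz p"]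
    by (simp add: enc_prod_def sz_def)
qed

section \<open>Polynomial bounds\<close>

text \<open>As \<open>sz a + 1 \<ge> 2\<close>, powers of it absorb constant factors and sums.\<close>

definition pb :: "('a::encodable \<Rightarrow> nat) \<Rightarrow> bool" where
  "pb g \<longleftrightarrow> (\<exists>c. \<forall>a. g a \<le> (sz a + 1) ^ c)"

lemma pb_mono: "pb h \<Longrightarrow> (\<And>a. g a \<le> h a) \<Longrightarrow> pb g"
  unfolding pb_def by (meson le_trans)

lemma le_two_pow: "n \<le> 2 ^ (n::nat)"
  by (simp add: less_imp_le)

lemma pb_const: "pb (\<lambda>_. n)"
  unfolding pb_def
proof (intro exI allI)
  fix a :: 'a
  have "(2::nat) ^ n \<le> (sz a + 1) ^ n"
    using sz_pos[of a] by (intro power_mono) linarith+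
  then show "n \<le> (sz a + 1) ^ n" using le_two_pow[of n] by linarith
qed

lemma pb_sz: "pb sz"
  unfolding pb_def by (intro exI[of _ 1]) simp

lemma pb_add: assumes "pb g" "pb h" shows "pb (\<lambda>a. g a + h a)"
proof -
  obtain c d where c: "\<And>a. g a \<le> (sz a + 1) ^ c" and d: "\<And>a. h a \<le> (sz a + 1) ^ d"
    using assms unfolding pb_def by blast
  have "g a + h a \<le> (sz a + 1) ^ (c + d + 1)" for a
  proof -
    let ?s = "sz a + 1"
    have s: "1 \<le> ?s" "2 \<le> ?s" using sz_pos[of a] by linarith+
    have "?s ^ c \<le> ?s ^ (c + d)" "?s ^ d \<le> ?s ^ (c + d)"
      using s by (auto intro: power_increasing)
    then have "g a + h a \<le> 2 * ?s ^ (c + d)" using c[of a] d[of a] by linarith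
    also have "\<dots> \<le> ?s * ?s ^ (c + d)" using s by (intro mult_right_mono) auto
    finally show ?thesis by simp
  qed
  then show ?thesis unfolding pb_def by blast
qed

lemma pb_mult: assumes "pb g" "pb h" shows "pb (\<lambda>a. g a * h a)"
proof -
  obtain c d where c: "\<And>a. g a \<le> (sz a + 1) ^ c" and d: "\<And>a. h a \<le> (sz a + 1) ^ d"
    using assms unfolding pb_def by blast
  have "g a * h a \<le> (sz a + 1) ^ (c + d)" for a
    unfolding power_add by (intro mult_mono c d) auto
  then show ?thesis unfolding pb_def by blast
qed

lemma pb_power: "pb g \<Longrightarrow> pb (\<lambda>a. g a ^ n)"
  by (induction n) (auto intro: pb_const pb_mult)

lemma pb_comp:
  assumes "pb g" "pb (\<lambda>a. sz (F a))" shows "pb (\<lambda>a. g (F a))"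
proof -
  obtain c where c: "\<And>a. g a \<le> (sz a + 1) ^ c"
    using assms unfolding pb_def by blast
  show ?thesis
    by (rule pb_mono[OF pb_power[OF pb_add[OF assms(2) pb_const]]]) (rule c)
qed

lemmas pb_intros = pb_const pb_sz pb_add pb_mult pb_power

section \<open>Polynomial-time functions\<close>

text \<open>The bound on the size of the output is not implied by the bound on the time, since
  trees are built with sharing.\<close>

definition pt :: "('a::encodable \<Rightarrow> 'b::encodable) \<Rightarrow> bool" where
  "pt F \<longleftrightarrow> (\<exists>\<tau>. pb \<tau> \<and> rt F \<tau>) \<and> pb (\<lambda>a. sz (F a))"

lemma ptI: "rt F \<tau> \<Longrightarrow> pb \<tau> \<Longrightarrow> pb (\<lambda>a. sz (F a)) \<Longrightarrow> pt F"
  unfolding pt_def by blast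

lemma pt_sz: "pt F \<Longrightarrow> pb (\<lambda>a. sz (F a))"
  unfolding pt_def by blast

lemma pt_rt: assumes "pt F" obtains c where "rt F (\<lambda>a. (sz a + 1) ^ c)"
proof -
  obtain \<tau> c where "rt F \<tau>" "\<And>a. \<tau> a \<le> (sz a + 1) ^ c"
    using assms unfolding pt_def pb_def by blast
  from rt_mono[OF this] show ?thesis by (rule that)
qed

text \<open>Reinterprets a value at another type with the same encoding: a pair as a nonempty list,
  a number as its list of digits.\<close>

lemma pt_coerce:
  fixes F :: "'a::encodable \<Rightarrow> 'b::encodable" and G :: "'a \<Rightarrow> 'c::encodable"
  assumes "pt F" "\<And>a. enc (F a) = enc (G a)" shows "pt G"
proof -
  obtain \<tau> where "pb \<tau>" "rt F \<tau>" using assms(1) unfolding pt_def by blast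
  then show ?thesis
    using pt_sz[OF assms(1)] by (intro ptI[OF rt_coerce[OF _ assms(2)]]) (simp_all add: sz_def assms(2))
qed

lemma pt_id: "pt (\<lambda>a. a)"
  by (rule ptI[OF rt_id]) (simp_all add: pb_intros)

lemma pt_const: "pt (\<lambda>a. c)"
  by (rule ptI[OF rt_const]) (simp_all only: pb_intros)

lemma pt_comp:
  assumes "pt F" "pt G" shows "pt (\<lambda>a. F (G a))"
proof -
  obtain \<tau> \<sigma> where t: "pb \<tau>" "rt F \<tau>" "pb \<sigma>" "rt G \<sigma>"
    using assms unfolding pt_def by blast
  show ?thesis
  proof (rule ptI[OF rt_comp[OF t(2,4)]])
    show "pb (\<lambda>a. \<sigma> a + \<tau> (G a) + 3)"
      by (intro pb_intros t pb_comp[OF t(1)] pt_sz assms)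
    show "pb (\<lambda>a. sz (F (G a)))"
      by (rule pb_comp[OF pt_sz[OF assms(1)] pt_sz[OF assms(2)]])
  qed
qed

lemma pt_fst: "pt f \<Longrightarrow> pt (\<lambda>a. fst (f a))"
  by (rule pt_comp, rule ptI[OF rt_fst]) (auto intro: pb_const pb_mono[OF pb_sz] sz_fst less_imp_le)

lemma pt_snd: "pt f \<Longrightarrow> pt (\<lambda>a. snd (f a))"
  by (rule pt_comp, rule ptI[OF rt_snd]) (auto intro: pb_const pb_mono[OF pb_sz] sz_snd less_imp_le)

lemma pt_tl:
  fixes f :: "'a::encodable \<Rightarrow> 'b::encodable list"
  shows "pt f \<Longrightarrow> pt (\<lambda>a. tl (f a))"
proof (rule pt_comp, rule ptI[OF rt_tl])
  have "sz (tl xs) \<le> sz xs" for xs :: "'b list" by (cases xs) auto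
  then show "pb (\<lambda>xs::'b list. sz (tl xs))" by (rule pb_mono[OF pb_sz])
qed (rule pb_const)

lemma pt_pair:
  assumes "pt f" "pt g" shows "pt (\<lambda>a. (f a, g a))"
proof -
  obtain \<tau> \<sigma> where t: "pb \<tau>" "rt f \<tau>" "pb \<sigma>" "rt g \<sigma>"
    using assms unfolding pt_def by blast
  show ?thesis
    by (rule ptI[OF rt_pair[OF t(2,4)]]) (auto intro!: pb_intros t pt_sz assms simp del: add_Suc_right)
qed

lemma pt_Cons: "pt f \<Longrightarrow> pt g \<Longrightarrow> pt (\<lambda>a. f a # g a)"
  by (rule pt_coerce[OF pt_pair]) simp_all

lemma pt_branch:
  fixes C :: "'a::encodable \<Rightarrow> 'c::encodable" and F :: "'d::encodable \<Rightarrow> 'b::encodable"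
  assumes "pt C" "pt F" "pt G"
    and m: "\<And>a. enc (C a) \<noteq> NIL \<Longrightarrow> enc (m a) = CONS (enc a) (enc (C a)) \<and> H a = F (m a)"
    and n: "\<And>a. enc (C a) = NIL \<Longrightarrow> H a = G a"
  shows "pt H"
proof -
  obtain \<tau> \<sigma> \<rho> where t: "pb \<tau>" "rt C \<tau>" "pb \<sigma>" "rt F \<sigma>" "pb \<rho>" "rt G \<rho>"
    using assms unfolding pt_def by blast
  obtain c where c: "\<And>a. \<sigma> a \<le> (sz a + 1) ^ c" using t(3) unfolding pb_def by blast
  obtain d where d: "\<And>a. sz (F a) \<le> (sz a + 1) ^ d" using pt_sz[OF assms(2)] unfolding pb_def by blast
  have szm: "sz (m a) = sz a + sz (C a) + 1" if "enc (C a) \<noteq> NIL" for a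
    using m[OF that] by (simp add: sz_def)
  show ?thesis
  proof (rule ptI)
    show "rt H (\<lambda>a. 2 * \<tau> a + (if enc (C a) = NIL then \<rho> a else \<sigma> (m a)) + 8)"
      by (rule rt_branch[OF t(2,4,6) m n])
    have "2 * \<tau> a + (if enc (C a) = NIL then \<rho> a else \<sigma> (m a)) + 8
      \<le> 2 * \<tau> a + (\<rho> a + (sz a + sz (C a) + 2) ^ c) + 8" for a
      using c[of "m a"] szm[of a] by auto
    then show "pb (\<lambda>a. 2 * \<tau> a + (if enc (C a) = NIL then \<rho> a else \<sigma> (m a)) + 8)"
      by (rule pb_mono[rotated]) (intro pb_intros t pt_sz assms)
    have "sz (H a) \<le> sz (G a) + (sz a + sz (C a) + 2) ^ d" for a
      using d[of "m a"] szm[of a] m[of a] n[of a] by (cases "enc (C a) = NIL") auto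
    then show "pb (\<lambda>a. sz (H a))"
      by (rule pb_mono[rotated]) (intro pb_intros pt_sz assms)
  qed
qed

lemma pt_if:
  assumes "pt c" "pt f" "pt g" shows "pt (\<lambda>a. if c a then f a else g a)"
  by (rule pt_branch[OF assms(1) pt_comp[OF assms(2) pt_fst[OF pt_id]] assms(3), of "\<lambda>a. (a, c a)"])
    (auto simp: enc_bool_def split: if_splits)

lemma pt_case_list:
  assumes "pt xs" "pt f" "pt (\<lambda>p. g (fst p) (fst (snd p)) (snd (snd p)))"
  shows "pt (\<lambda>a. case xs a of [] \<Rightarrow> f a | x # r \<Rightarrow> g a x r)"
  by (rule pt_branch[OF assms(1) assms(3) assms(2), of "\<lambda>a. (a, hd (xs a), tl (xs a))"])
    (auto split: list.splits)

lemma pt_not: "pt c \<Longrightarrow> pt (\<lambda>a. \<not> c a)"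
  using pt_if[of c "\<lambda>_. False" "\<lambda>_. True", OF _ pt_const pt_const] by (simp add: if_bool_eq_conj)

lemma pt_conj: assumes "pt c" "pt d" shows "pt (\<lambda>a. c a \<and> d a)"
proof -
  have "(\<lambda>a. c a \<and> d a) = (\<lambda>a. if c a then d a else False)" by auto
  then show ?thesis by (rule ssubst) (intro pt_if pt_const assms)
qed

lemma pt_disj: assumes "pt c" "pt d" shows "pt (\<lambda>a. c a \<or> d a)"
proof -
  have "(\<lambda>a. c a \<or> d a) = (\<lambda>a. if c a then True else d a)" by auto
  then show ?thesis by (rule ssubst) (intro pt_if pt_const assms)
qed

lemma pt_eq:
  assumes "pt f" "pt g" shows "pt (\<lambda>a. f a = g a)"
proof -
  have "pt (\<lambda>p::'b \<times> 'b. fst p = snd p)"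
    by (rule ptI[OF rt_eq]) (intro pb_intros, rule pb_mono[OF pb_const sz_bool])
  from pt_comp[OF this pt_pair[OF assms]] show ?thesis by simp
qed

lemma sz_foldl_le:
  assumes "\<And>s x. x \<in> set ys \<Longrightarrow> sz (f s x) \<le> sz s + B"
  shows "sz (foldl f s ys) \<le> sz s + length ys * B"
  using assms
proof (induction ys arbitrary: s)
  case (Cons y ys)
  have "sz (foldl f (f s y) ys) \<le> sz (f s y) + length ys * B"
    using Cons.prems by (intro Cons.IH) auto
  also have "sz (f s y) \<le> sz s + B" using Cons.prems by simp
  finally show ?case by simp
qed simp

text \<open>The growth \<open>g\<close> may depend on the parameter and the list element but not on
  the accumulator. This excludes repeated doubling, which would be cheap in time thanks to sharing
  but exponential in size.\<close>

lemma pt_foldl: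
  assumes step: "pt (\<lambda>p. f (fst p) (fst (snd p)) (snd (snd p)))"
    and s0: "pt s0" and xs: "pt xs" and g: "pb g"
    and grow: "\<And>a s x. sz (f a s x) \<le> sz s + g (a, x)"
  shows "pt (\<lambda>a. foldl (f a) (s0 a) (xs a))"
proof -
  obtain c where c: "rt (\<lambda>p. f (fst p) (fst (snd p)) (snd (snd p))) (\<lambda>p. (sz p + 1) ^ c)"
    using step by (rule pt_rt)
  obtain d where d: "\<And>p. g p \<le> (sz p + 1) ^ d" using g unfolding pb_def by blast
  \<comment> \<open>\<open>R a\<close> bounds the accumulator after every prefix of the list, hence
    also the input of every single step.\<close>
  define R where "R a = sz (s0 a) + sz (xs a) * (sz a + sz (xs a) + 2) ^ d" for a
  have pbR: "pb R" unfolding R_def by (intro pb_intros pt_sz s0 xs)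
  have R: "sz (foldl (f a) (s0 a) ys) \<le> R a" if "xs a = ys @ zs" for a ys zs
  proof -
    have "sz (foldl (f a) (s0 a) ys) \<le> sz (s0 a) + length ys * (sz a + sz (xs a) + 2) ^ d"
    proof (rule sz_foldl_le)
      fix s x assume "x \<in> set ys"
      then have "sz x < sz (xs a)" by (intro sz_mem) (simp add: that)
      then have "(sz (a, x) + 1) ^ d \<le> (sz a + sz (xs a) + 2) ^ d" by (intro power_mono) auto
      then show "sz (f a s x) \<le> sz s + (sz a + sz (xs a) + 2) ^ d"
        using grow[of a s x] d[of "(a, x)"] by linarith
    qed
    moreover have "length ys \<le> sz (xs a)" using length_less_sz[of "xs a"] that by simp
    ultimately show ?thesis unfolding R_def by (meson add_left_mono le_trans mult_le_mono1)
  qed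
  define T where "T a = (sz a + R a + sz (xs a) + 3) ^ c" for a
  have pbT: "pb T" unfolding T_def by (intro pb_intros pt_sz xs pbR pt_id)
  have T: "fold_time (\<lambda>q. (sz (a, q) + 1) ^ c) (f a) (s0 a) (xs a) \<le> (sz (xs a) + 1) * (T a + 30)" for a
  proof -
    have "fold_time (\<lambda>q. (sz (a, q) + 1) ^ c) (f a) (s0 a) (xs a) \<le> (length (xs a) + 1) * (T a + 30)"
    proof (rule fold_time_le)
      fix ys x zs assume e: "xs a = ys @ x # zs"
      have "sz x < sz (xs a)" by (intro sz_mem) (simp add: e)
      then show "(sz (a, foldl (f a) (s0 a) ys, x) + 1) ^ c \<le> T a"
        unfolding T_def using R[OF e] by (intro power_mono) auto
    qed
    also have "\<dots> \<le> (sz (xs a) + 1) * (T a + 30)"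
      using length_less_sz[of "xs a"] by (intro mult_right_mono) auto
    finally show ?thesis .
  qed
  obtain \<sigma> where s: "pb \<sigma>" "rt (\<lambda>a. (a, s0 a, xs a)) \<sigma>"
    using pt_pair[OF pt_id pt_pair[OF s0 xs]] unfolding pt_def by blast
  show ?thesis
  proof (rule ptI)
    show "rt (\<lambda>a. foldl (f a) (s0 a) (xs a)) (\<lambda>a. \<sigma> a + (sz (xs a) + 1) * (T a + 30) + 3)"
      by (rule rt_mono[OF rt_comp[OF rt_foldl[OF c] s(2), unfolded fst_conv snd_conv]])
        (use T in \<open>simp only: add_le_mono le_refl\<close>)
    show "pb (\<lambda>a. \<sigma> a + (sz (xs a) + 1) * (T a + 30) + 3)"
      by (intro pb_intros s pt_sz xs pbT)
    show "pb (\<lambda>a. sz (foldl (f a) (s0 a) (xs a)))"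
      by (rule pb_mono[OF pbR]) (use R[of _ _ "[]"] in auto)
  qed
qed

section \<open>List functions in polynomial time\<close>

lemma pt_rev: assumes "pt xs" shows "pt (\<lambda>a. rev (xs a))"
proof -
  have "pt (\<lambda>a. foldl (\<lambda>s x. x # s) [] (xs a))"
    by (rule pt_foldl[where g = "\<lambda>p. sz p"]) (auto intro!: pt_const pt_Cons pt_fst pt_snd pt_id assms pb_sz)
  moreover have "foldl (\<lambda>s x. x # s) s xs = rev xs @ s" for s xs :: "'b list"
    by (induction xs arbitrary: s) auto
  ultimately show ?thesis by simp
qed

lemma pt_append: assumes "pt xs" "pt ys" shows "pt (\<lambda>a. xs a @ ys a)"
proof -
  have "pt (\<lambda>a. foldl (\<lambda>s x. x # s) (ys a) (rev (xs a)))"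
    by (rule pt_foldl[where g = "\<lambda>p. sz p"])
      (auto intro!: pt_const pt_Cons pt_fst pt_snd pt_id assms pb_sz pt_rev)
  moreover have "foldl (\<lambda>s x. x # s) s xs = rev xs @ s" for s xs :: "'b list"
    by (induction xs arbitrary: s) auto
  ultimately show ?thesis by simp
qed

lemma pt_map:
  assumes f: "pt (\<lambda>p. f (fst p) (snd p))" and xs: "pt xs"
  shows "pt (\<lambda>a. map (f a) (xs a))"
proof -
  have "pt (\<lambda>p. f (fst p) (snd (snd p)))"
    using pt_comp[OF f pt_pair[OF pt_fst[OF pt_id] pt_snd[OF pt_snd[OF pt_id]]]] by simp
  then have "pt (\<lambda>a. foldl (\<lambda>s x. f a x # s) [] (xs a))"
    by (intro pt_foldl[where g = "\<lambda>p. sz (f (fst p) (snd p)) + 1"])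
      (auto intro!: pt_const pt_Cons pt_fst pt_snd pt_id xs pb_add pb_const pt_sz[OF f] simp del: One_nat_def)
  from pt_rev[OF this] have "pt (\<lambda>a. rev (foldl (\<lambda>s x. f a x # s) [] (xs a)))" .
  moreover have "foldl (\<lambda>s x. f a x # s) s xs = rev (map (f a) xs) @ s" for a s xs
    by (induction xs arbitrary: s) auto
  ultimately show ?thesis by simp
qed

lemma pt_filter:
  assumes f: "pt (\<lambda>p. f (fst p) (snd p))" and xs: "pt xs"
  shows "pt (\<lambda>a. filter (f a) (xs a))"
proof -
  have "pt (\<lambda>p. f (fst p) (snd (snd p)))"
    using pt_comp[OF f pt_pair[OF pt_fst[OF pt_id] pt_snd[OF pt_snd[OF pt_id]]]] by simp
  then have "pt (\<lambda>a. foldl (\<lambda>s x. if f a x then x # s else s) [] (xs a))"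
    by (intro pt_foldl[where g = "\<lambda>p. sz p"])
      (auto intro!: pt_const pt_Cons pt_fst pt_snd pt_id pt_if xs pb_sz)
  from pt_rev[OF this] have "pt (\<lambda>a. rev (foldl (\<lambda>s x. if f a x then x # s else s) [] (xs a)))" .
  moreover have "foldl (\<lambda>s x. if f a x then x # s else s) s xs = rev (filter (f a) xs) @ s" for a s xs
    by (induction xs arbitrary: s) auto
  ultimately show ?thesis by simp
qed

lemma pt_list_ex:
  assumes f: "pt (\<lambda>p. f (fst p) (snd p))" and xs: "pt xs"
  shows "pt (\<lambda>a. list_ex (f a) (xs a))"
proof -
  have "list_ex (f a) (xs a) \<longleftrightarrow> filter (f a) (xs a) \<noteq> []" for a
    by (auto simp: list_ex_iff filter_empty_conv)
  then show ?thesis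
    using pt_not[OF pt_eq[OF pt_filter[OF f xs] pt_const[of "[]"]]] by simp
qed

lemma pt_list_all:
  assumes f: "pt (\<lambda>p. f (fst p) (snd p))" and xs: "pt xs"
  shows "pt (\<lambda>a. list_all (f a) (xs a))"
proof -
  have "list_all (f a) (xs a) \<longleftrightarrow> \<not> list_ex (\<lambda>x. \<not> f a x) (xs a)" for a
    by (auto simp: list_ex_iff list_all_iff)
  then show ?thesis
    using pt_not[OF pt_list_ex[OF pt_not[OF f] xs]] by simp
qed

lemma pt_member:
  assumes "pt f" "pt xs" shows "pt (\<lambda>a. f a \<in> set (xs a))"
proof -
  have "pt (\<lambda>a. list_ex (\<lambda>y. f a = y) (xs a))"
    by (intro pt_list_ex pt_eq pt_snd pt_id assms pt_comp[OF assms(1) pt_fst[OF pt_id]])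
  then show ?thesis by (simp add: list_ex_iff)
qed

lemma pt_concat: assumes "pt xs" shows "pt (\<lambda>a. concat (xs a))"
proof -
  have "pt (\<lambda>a. foldl (\<lambda>s x. s @ x) [] (xs a))"
  proof (rule pt_foldl[where g = "\<lambda>p. sz p"])
    show "sz (s @ x) \<le> sz s + sz (a, x)" for a s and x :: "'b list"
      using sz_append[of s x] by simp
  qed (intro pt_const pt_append pt_fst pt_snd pt_id assms pb_sz)+
  moreover have "foldl (\<lambda>s x. s @ x) s xs = s @ concat xs" for s and xs :: "'b list list"
    by (induction xs arbitrary: s) auto
  ultimately show ?thesis by simp
qed

lemma pt_remdups: assumes "pt xs" shows "pt (\<lambda>a. remdups (xs a))"
proof -
  have "pt (\<lambda>a. foldl (\<lambda>s x. if x \<in> set s then s else x # s) [] (rev (xs a)))"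
    by (rule pt_foldl[where g = "\<lambda>p. sz p"])
      (auto intro!: pt_const pt_Cons pt_fst pt_snd pt_id pt_if pt_member assms pb_sz pt_rev)
  moreover have "foldl (\<lambda>s x. if x \<in> set s then s else x # s) [] (rev xs) = remdups xs" for xs :: "'b list"
    by (induction xs) auto
  ultimately show ?thesis by simp
qed

lemma pt_product: assumes "pt xs" "pt ys" shows "pt (\<lambda>a. List.product (xs a) (ys a))"
proof -
  have "pt (\<lambda>a. concat (map (\<lambda>x. map (Pair x) (ys a)) (xs a)))"
    by (intro pt_concat pt_map pt_pair pt_fst pt_snd pt_id assms pt_comp[OF assms(2) pt_fst[OF pt_id]])
  then show ?thesis by (simp add: product_concat_map)
qed

lemma pt_drop: assumes "pt xs" "pt ys" shows "pt (\<lambda>a. drop (length (xs a)) (ys a))"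
proof -
  have "pt (\<lambda>a. foldl (\<lambda>s x. tl s) (ys a) (xs a))"
  proof (rule pt_foldl[where g = "\<lambda>p. sz p"])
    show "sz (tl s) \<le> sz s + sz (a, x)" for a x and s :: "'c list"
      by (cases s) auto
  qed (intro pt_const pt_tl pt_fst pt_snd pt_id assms pb_sz)+
  moreover have "foldl (\<lambda>s x. tl s) ys xs = drop (length xs) ys" for xs :: "'b list" and ys :: "'c list"
    by (induction xs arbitrary: ys) (auto simp: drop_Suc)
  ultimately show ?thesis by simp
qed

lemmas pt_intros = pt_const pt_id pt_pair pt_Cons pt_if pt_case_list pt_not pt_conj pt_disj pt_eq
  pt_rev pt_append pt_map pt_filter pt_list_ex pt_list_all pt_member pt_concat pt_remdups
  pt_product pt_drop pt_fst pt_snd pt_tl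

fun bits :: "nat \<Rightarrow> bool list" where
  "bits n = (if n = 0 then [] else odd n # bits (n div 2))"

declare bits.simps [simp del]

text \<open>A number is already stored as the list of its digits, so access to them is a mere change
  of type.\<close>

lemma enc_bits: "enc (bits n) = enc n"
proof (induction n rule: bits.induct)
  case (1 n)
  then show ?case by (subst bits.simps) (simp add: enc_nat.simps[of n])
qed

lemma pt_bits: "pt f \<Longrightarrow> pt (\<lambda>a. bits (f a))"
  by (rule pt_coerce[of f]) (simp_all add: enc_bits del: enc_nat')

section \<open>Distances\<close>

text \<open>Infinite distances become \<open>N\<close> as well. The result can be found by
  \<open>N\<close> rounds of breadth-first search.\<close>

definition capd :: "'a set \<Rightarrow> 'a set set \<Rightarrow> nat \<Rightarrow> 'a \<Rightarrow> 'a \<Rightarrow> nat" where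
  "capd V E N u v = the_enat (min (gdist V E u v) (enat N))"

lemma gdist_le_iff: "gdist V E u v \<le> enat n \<longleftrightarrow> (\<exists>p. walk V E u p v \<and> length p \<le> Suc n)"
proof
  let ?A = "{enat (length p - 1) | p. walk V E u p v}"
  assume le: "gdist V E u v \<le> enat n"
  then have "?A \<noteq> {}" unfolding gdist_def Inf_enat_def by (cases "?A = {}") auto
  then have "Inf ?A \<in> ?A" unfolding Inf_enat_def by (metis (mono_tags, lifting) LeastI ex_in_conv)
  then show "\<exists>p. walk V E u p v \<and> length p \<le> Suc n"
    using le unfolding gdist_def by fastforce
next
  assume "\<exists>p. walk V E u p v \<and> length p \<le> Suc n"
  then obtain p where p: "walk V E u p v" "length p \<le> Suc n" by blast
  then have "gdist V E u v \<le> enat (length p - 1)"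
    unfolding gdist_def by (intro Inf_lower) blast
  also have "\<dots> \<le> enat n" using p by simp
  finally show "gdist V E u v \<le> enat n" .
qed

lemma gdist_le_0_iff: "u \<in> V \<Longrightarrow> gdist V E u v \<le> enat 0 \<longleftrightarrow> u = v"
proof
  assume "gdist V E u v \<le> enat 0"
  then obtain p where "walk V E u p v" "length p \<le> 1" by (auto simp: gdist_le_iff)
  then show "u = v" unfolding walk_def by (cases p) auto
next
  assume "u \<in> V" "u = v"
  then have "walk V E u [u] v" unfolding walk_def by auto
  then show "gdist V E u v \<le> enat 0" unfolding gdist_le_iff by fastforce
qed

text \<open>The recurrence of breadth-first search, obtained by splitting off the last edge of a
  walk.\<close>

lemma gdist_le_Suc_iff:
  assumes "simple_graph V E"
  shows "gdist V E u v \<le> enat (Suc i) \<longleftrightarrow>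
    gdist V E u v \<le> enat i \<or> (\<exists>b. gdist V E u b \<le> enat i \<and> {b, v} \<in> E)"
proof (intro iffI)
  assume "gdist V E u v \<le> enat (Suc i)"
  then obtain p where p: "walk V E u p v" "length p \<le> Suc (Suc i)" by (auto simp: gdist_le_iff)
  show "gdist V E u v \<le> enat i \<or> (\<exists>b. gdist V E u b \<le> enat i \<and> {b, v} \<in> E)"
  proof (cases "length p \<le> Suc i")
    case True
    then show ?thesis using p by (auto simp: gdist_le_iff)
  next
    case False
    define q where "q = butlast p"
    have pq: "p = q @ [v]" using p(1) append_butlast_last_id unfolding walk_def q_def by metis
    have q: "q \<noteq> []" using False pq by auto
    then have "walk V E u q (last q)" "{last q, v} \<in> E"
      using p(1) unfolding walk_def pq by (auto simp: successively_append_iff)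
    moreover have "length q \<le> Suc i" using p pq by simp
    ultimately show ?thesis unfolding gdist_le_iff by blast
  qed
next
  assume "gdist V E u v \<le> enat i \<or> (\<exists>b. gdist V E u b \<le> enat i \<and> {b, v} \<in> E)"
  then consider "gdist V E u v \<le> enat i" | b where "gdist V E u b \<le> enat i" "{b, v} \<in> E" by blast
  then show "gdist V E u v \<le> enat (Suc i)"
  proof cases
    case 1
    then show ?thesis by (meson enat_ord_simps(1) le_SucI le_refl order_trans)
  next
    case 2
    then obtain p where p: "walk V E u p b" "length p \<le> Suc i" by (auto simp: gdist_le_iff)
    have "v \<in> V" using 2 assms unfolding simple_graph_def by auto
    then have "walk V E u (p @ [v]) v"
      using p 2 unfolding walk_def by (auto simp: successively_append_iff)
    then show ?thesis using p unfolding gdist_le_iff by (intro exI[of _ "p @ [v]"]) simp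
  qed
qed

lemma gdist_commute: "gdist V E u v = gdist V E v u"
proof -
  have "walk V E v (rev p) u" if "walk V E u p v" for u p v
    using that unfolding walk_def by (auto simp: successively_rev hd_rev last_rev insert_commute)
  then have *: "gdist V E u v \<le> enat n \<Longrightarrow> gdist V E v u \<le> enat n" for u v n
    unfolding gdist_le_iff using length_rev by metis
  have "gdist V E v u \<le> gdist V E u v" for u v
  proof (cases "gdist V E u v")
    case (enat m)
    then show ?thesis using *[of u v m] by simp
  qed simp
  then show ?thesis by (intro antisym)
qed

lemma capd_le: "capd V E N u v \<le> N"
  unfolding capd_def by (cases "gdist V E u v") (auto simp: min_def)

lemma capd_le_iff: "i < N \<Longrightarrow> capd V E N u v \<le> i \<longleftrightarrow> gdist V E u v \<le> enat i"
  unfolding capd_def by (cases "gdist V E u v") (auto simp: min_def)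

lemma capd_commute: "capd V E N u v = capd V E N v u"
  unfolding capd_def by (simp add: gdist_commute)

lemma gdist_capd: "capd V E N u v < N \<Longrightarrow> gdist V E u v = enat (capd V E N u v)"
  unfolding capd_def by (cases "gdist V E u v") (auto simp: min_def split: if_splits)

text \<open>The cap stays a parameter because the bound on distances is first derived with a cap
  just above a given distance, and only then with the cap of the algorithm. It is positive so that
  distance 0 still means equality.\<close>

locale capped_graph =
  fixes V :: "'a set" and E :: "'a set set" and N :: nat
  assumes graph: "simple_graph V E" and N: "0 < N"
begin

abbreviation "d \<equiv> capd V E N"

lemma edge_verts: "{a, b} \<in> E \<Longrightarrow> a \<in> V \<and> b \<in> V \<and> a \<noteq> b"
  using graph unfolding simple_graph_def by fastforce

lemma d_0_iff: "u \<in> V \<Longrightarrow> d u v = 0 \<longleftrightarrow> u = v"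
  using capd_le_iff[OF N, of V E u v] gdist_le_0_iff[of u V E v] by simp

lemma d_le_Suc_iff: "Suc i < N \<Longrightarrow> d u v \<le> Suc i \<longleftrightarrow> d u v \<le> i \<or> (\<exists>b. d u b \<le> i \<and> {b, v} \<in> E)"
  using gdist_le_Suc_iff[OF graph, of u v i] by (simp add: capd_le_iff)

lemma d_edge: "{b, v} \<in> E \<Longrightarrow> d u v \<le> Suc (d u b)"
  using d_le_Suc_iff[of "d u b" u v] capd_le[of V E N u v] by (cases "Suc (d u b) < N") auto

lemma d_pred: "d u v = Suc i \<Longrightarrow> Suc i < N \<Longrightarrow> \<exists>b. d u b = i \<and> {b, v} \<in> E"
  using d_le_Suc_iff[of i u v] d_edge[of _ v u] by (fastforce intro: antisym)

lemma d_edge_le_1: "{b, v} \<in> E \<Longrightarrow> d b v \<le> 1"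
  using d_edge[of b v b] d_0_iff[of b b] edge_verts by fastforce

lemma d_adjacent: "{b, v} \<in> E \<Longrightarrow> d b v = 1"
  using d_edge_le_1[of b v] d_0_iff[of b v] edge_verts[of b v] by linarith

text \<open>Induction along a shortest path from \<open>v\<close> to \<open>w\<close>. If
  \<open>d v w\<close> has reached the cap, the claim is trivial because \<open>d u w\<close> cannot
  exceed it.\<close>

lemma d_triangle: "v \<in> V \<Longrightarrow> d u w \<le> d u v + d v w"
proof (induction "d v w" arbitrary: w)
  case 0
  then show ?case using d_0_iff[of v w] by simp
next
  case (Suc n)
  show ?case
  proof (cases "Suc n < N")
    case True
    then obtain b where b: "d v b = n" "{b, w} \<in> E" using d_pred[of v w n] Suc by metis
    then have "d u b \<le> d u v + d v b" using Suc.hyps(1)[of b] Suc.prems by simp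
    then show ?thesis using d_edge[OF b(2), of u] b Suc by simp
  next
    case False
    then show ?thesis using capd_le[of V E N u w] Suc by linarith
  qed
qed

lemma d_prefix: "d u v < N \<Longrightarrow> i \<le> d u v \<Longrightarrow> \<exists>x. d u x = i"
proof (induction "d u v" arbitrary: v)
  case (Suc n)
  show ?case
  proof (cases "i = Suc n")
    case False
    obtain b where "d u b = n" using d_pred[of u v n] Suc by metis
    then show ?thesis using Suc.hyps(1)[of b] Suc False by simp
  qed (use Suc in auto)
qed auto

end

section \<open>Cluster modulators\<close>

text \<open>\<open>no_P3\<close> is the forbidden-subgraph form of "\<open>G - X\<close> is a
  cluster graph": there is no induced path on three vertices outside \<open>X\<close>.\<close>

locale modulated_graph = capped_graph +
  fixes X :: "'a set"
  assumes XV: "X \<subseteq> V"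
    and no_P3: "\<And>a b c. {a, b} \<in> E \<Longrightarrow> {b, c} \<in> E \<Longrightarrow> a \<noteq> c \<Longrightarrow> a \<notin> X \<Longrightarrow> b \<notin> X \<Longrightarrow> c \<notin> X \<Longrightarrow> {a, c} \<in> E"
begin

lemma d_modulator:
  assumes "i + 2 \<le> d u v" "d u v < N"
  shows "\<exists>x\<in>X. d u x \<in> {i, i + 1, i + 2}"
proof -
  obtain c where c: "d u c = i + 2" using d_prefix[OF assms(2,1)] by blast
  then obtain b where b: "d u b = i + 1" "{b, c} \<in> E" using d_pred[of u c "i + 1"] assms by auto
  then obtain a where a: "d u a = i" "{a, b} \<in> E" using d_pred[of u b i] assms by auto
  \<comment> \<open>An edge \<open>{a, c}\<close> would put \<open>c\<close> at distance at most
    \<open>i + 1\<close> from \<open>u\<close>. Hence the three vertices induce a path.\<close>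
  have "a \<noteq> c" "{a, c} \<notin> E" using d_edge[of a c u] a b c by auto
  then have "a \<in> X \<or> b \<in> X \<or> c \<in> X" using no_P3 a b by blast
  then show ?thesis using a b c by auto
qed

text \<open>Every three consecutive vertices of a shortest path contain a vertex of the modulator.\<close>

lemma d_bound:
  assumes "d u v < N" shows "d u v \<le> 3 * card X + 1"
proof -
  \<comment> \<open>\<open>j\<close> numbers the disjoint blocks of distances \<open>3 * j\<close>,
    \<open>3 * j + 1\<close>, \<open>3 * j + 2\<close> from \<open>u\<close>. Modulator vertices
    found in different blocks differ.\<close>
  define J where "J = {j. 3 * j + 2 \<le> d u v}"
  define \<phi> where "\<phi> j = (SOME x. x \<in> X \<and> d u x \<in> {3 * j, 3 * j + 1, 3 * j + 2})" for j
  have \<phi>: "\<phi> j \<in> X \<and> d u (\<phi> j) \<in> {3 * j, 3 * j + 1, 3 * j + 2}" if "j \<in> J" for j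
    using someI_ex[of "\<lambda>x. x \<in> X \<and> d u x \<in> {3 * j, 3 * j + 1, 3 * j + 2}"]
      d_modulator[of "3 * j" u v] that assms unfolding \<phi>_def J_def by blast
  have "inj_on \<phi> J"
  proof (rule inj_onI)
    fix i j assume ij: "i \<in> J" "j \<in> J" "\<phi> i = \<phi> j"
    have "3 * i \<le> d u (\<phi> i)" "d u (\<phi> i) \<le> 3 * i + 2" using \<phi>[OF ij(1)] by auto
    moreover have "3 * j \<le> d u (\<phi> j)" "d u (\<phi> j) \<le> 3 * j + 2" using \<phi>[OF ij(2)] by auto
    ultimately show "i = j" unfolding ij(3) by linarith
  qed
  moreover have "finite X" using XV graph finite_subset unfolding simple_graph_def by blast
  ultimately have "card J \<le> card X" using \<phi> by (intro card_inj_on_le) auto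
  moreover have "3 * j + 2 \<le> n \<longleftrightarrow> j < (n + 1) div 3" for j n :: nat by presburger
  then have "J = {..<(d u v + 1) div 3}" unfolding J_def by blast
  ultimately have "(d u v + 1) div 3 \<le> card X" by simp
  then show ?thesis by linarith
qed

text \<open>Induction along a shortest path from \<open>u\<close>: as long as it avoids
  \<open>X\<close>, \<open>no_P3\<close> contracts it to a single edge, so it cannot leave the
  clique of \<open>u\<close> without meeting \<open>X\<close>.\<close>

lemma d_through_modulator:
  assumes "u \<in> V" "u \<notin> X" "w \<notin> X" "d u w < N"
  shows "w = u \<or> {u, w} \<in> E \<or> (\<exists>x\<in>X. d u x + d x w = d u w)"
  using assms(3,4)
proof (induction "d u w" arbitrary: w)
  case 0
  then show ?case using d_0_iff[OF assms(1)] by simp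
next
  case (Suc n)
  then obtain b where b: "d u b = n" "{b, w} \<in> E" using d_pred[of u w n] by metis
  show ?case
  proof (cases "b \<in> X")
    case True
    then show ?thesis using b Suc d_adjacent[OF b(2)] by (intro disjI2 bexI[of _ b]) auto
  next
    case False
    with Suc b have "b = u \<or> {u, b} \<in> E \<or> (\<exists>x\<in>X. d u x + d x b = d u b)" by auto
    then consider "b = u" | "{u, b} \<in> E" | x where "x \<in> X" "d u x + d x b = n" using b by blast
    then show ?thesis
    proof cases
      case 1
      then show ?thesis using b by simp
    next
      case 2
      then show ?thesis using no_P3[of u b w] b assms Suc False by auto
    next
      case 3
      have "d x w \<le> Suc (d x b)" using d_edge[OF b(2)] .
      moreover have "d u w \<le> d u x + d x w" using d_triangle 3 XV by blast
      ultimately show ?thesis using 3 Suc by (intro disjI2 bexI[of _ x]) auto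
    qed
  qed
qed

definition same_profile :: "'a \<Rightarrow> 'a \<Rightarrow> bool" where
  "same_profile w w' \<longleftrightarrow> (\<forall>x\<in>X. d w x = d w' x)"

text \<open>Between vertices outside \<open>X\<close>: belonging to the same clique of
  \<open>G - X\<close>.\<close>

definition near :: "'a \<Rightarrow> 'a \<Rightarrow> bool" where
  "near u w \<longleftrightarrow> w = u \<or> {u, w} \<in> E"

lemma near_trans:
  assumes "near u w" "near u w'" "u \<notin> X" "w \<notin> X" "w' \<notin> X" shows "near w w'"
  using assms no_P3[of w u w'] unfolding near_def by (auto simp: insert_commute)

lemma near_sym: "near u w \<longleftrightarrow> near w u"
  unfolding near_def by (auto simp: insert_commute)

text \<open>The profile of a vertex in \<open>X\<close> has a zero at that vertex itself, and only
  there can the other vertex be.\<close>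

lemma same_profile_modulator: "w \<in> X \<Longrightarrow> same_profile w w' \<Longrightarrow> w' \<in> V \<Longrightarrow> w' = w"
  using d_0_iff[of w w] d_0_iff[of w' w] XV unfolding same_profile_def by auto

text \<open>A shortest path from \<open>u\<close> to \<open>w\<close> passes through some
  \<open>x\<close> in \<open>X\<close>, and its part behind \<open>x\<close> can be replaced by an
  equally long path to \<open>w'\<close>.\<close>

lemma far_same_profile:
  assumes "u \<in> V" "w \<in> V" "same_profile w w'" "d u w < N" "w \<notin> X" "u \<in> X \<or> \<not> near u w"
  shows "d u w' \<le> d u w"
proof (cases "u \<in> X")
  case True
  then show ?thesis using assms unfolding same_profile_def by (simp add: capd_commute[of _ _ _ u])
next
  case False
  then obtain x where x: "x \<in> X" "d u x + d x w = d u w"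
    using d_through_modulator[of u w] assms unfolding near_def by blast
  have "d u w' \<le> d u x + d x w'" using d_triangle x XV by blast
  also have "d x w' = d x w" using assms x unfolding same_profile_def by (simp add: capd_commute[of _ _ _ x])
  finally show ?thesis using x by simp
qed

definition between :: "'a \<Rightarrow> 'a \<Rightarrow> 'a \<Rightarrow> bool" where
  "between u w v \<longleftrightarrow> d u w + d w v = d u v"

text \<open>Upper bounds suffice, since the triangle inequality through \<open>w'\<close> gives the
  converse.\<close>

lemma betweenI: "w' \<in> V \<Longrightarrow> between u w v \<Longrightarrow> d u w' \<le> d u w \<Longrightarrow> d v w' \<le> d v w \<Longrightarrow> between u w' v"
  using d_triangle[of w' u v] unfolding between_def
  by (simp add: capd_commute[of _ _ _ v])

text \<open>A vertex can only be distinguished from the vertices of the same profile, as far as its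
  membership in intervals is concerned, by an endpoint in its own clique.\<close>

lemma between_far:
  assumes "u \<in> V" "v \<in> V" "d u v < N" "w \<in> V" "w' \<in> V" "between u w v" "same_profile w w'"
    and "\<not> (u \<notin> X \<and> w \<notin> X \<and> near u w)" "\<not> (v \<notin> X \<and> w \<notin> X \<and> near v w)"
  shows "between u w' v"
proof (cases "w \<in> X")
  case True
  then show ?thesis using same_profile_modulator assms by blast
next
  case False
  have "d u w < N" "d v w < N" using assms unfolding between_def by (auto simp: capd_commute[of _ _ _ v])
  then have "d u w' \<le> d u w" "d v w' \<le> d v w"
    using far_same_profile[of u w w'] far_same_profile[of v w w'] assms False by auto
  then show ?thesis using betweenI assms by blast
qed

text \<open>An endpoint in the clique of \<open>w\<close> is also near \<open>w'\<close>, so its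
  distance to \<open>w'\<close> is at most 1, while that to \<open>w\<close> is at least 1. All
  other endpoints are handled by the profile.\<close>

lemma between_near:
  assumes "u \<in> V" "v \<in> V" "d u v < N" "w \<in> V" "w' \<in> V" "between u w v" "same_profile w w'"
    and "w \<notin> X" "w' \<notin> X" "near w w'" "w \<noteq> u" "w \<noteq> v"
  shows "between u w' v"
proof -
  have *: "d z w' \<le> d z w" if z: "z \<in> V" "d z w < N" "w \<noteq> z" for z
  proof (cases "z \<notin> X \<and> near z w")
    case True
    then have "near z w'" using near_trans[of w z w'] assms near_sym[of z] by blast
    then have "d z w' \<le> 1"
      unfolding near_def using d_edge_le_1 d_0_iff[of z z] z by auto
    moreover have "d z w \<noteq> 0" using d_0_iff z by auto
    ultimately show ?thesis by linarith
  next
    case False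
    then show ?thesis using far_same_profile assms z by blast
  qed
  have "d u w < N" "d v w < N" using assms unfolding between_def by (auto simp: capd_commute[of _ _ _ v])
  then show ?thesis
    using betweenI[OF assms(5,6) *[OF assms(1)] *[OF assms(2)]] assms by simp
qed

end

section \<open>The algorithm\<close>

definition adj :: "(nat \<times> nat) list \<Rightarrow> nat \<Rightarrow> nat \<Rightarrow> bool" where
  "adj es a b \<longleftrightarrow> (a, b) \<in> set es \<or> (b, a) \<in> set es"

definition modulator_step :: "(nat \<times> nat) list \<Rightarrow> nat list \<Rightarrow> nat \<times> nat \<times> nat \<Rightarrow> nat list" where
  "modulator_step es X t = (let a = fst t; b = fst (snd t); c = snd (snd t) in
     if adj es a b \<and> adj es b c \<and> \<not> adj es a c \<and> \<not> a = c \<and> \<not> a \<in> set X \<and> \<not> b \<in> set X \<and> \<not> c \<in> set X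
     then a # b # c # X else X)"

definition modulator :: "nat list \<Rightarrow> (nat \<times> nat) list \<Rightarrow> nat list" where
  "modulator vs es = foldl (modulator_step es) [] (List.product vs (List.product vs vs))"

text \<open>The number \<open>3 * length X + 2\<close> in unary: one more than the bound of
  \<open>d_bound\<close>.\<close>

definition cap :: "nat list \<Rightarrow> unit list" where
  "cap X = map (\<lambda>_. ()) (X @ X @ X) @ [(), ()]"

text \<open>A state holds a ball around the source and its radius in unary. It freezes once the ball
  contains \<open>v\<close>, so the final radius is the capped distance to \<open>v\<close>.
  Filtering \<open>vs\<close> keeps the ball no larger than \<open>vs\<close>.\<close>

definition ball_step :: "nat list \<Rightarrow> (nat \<times> nat) list \<Rightarrow> nat \<Rightarrow> nat list \<times> unit list \<Rightarrow> nat list \<times> unit list" where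
  "ball_step vs es v s =
     (if v \<in> set (fst s) then s
      else (filter (\<lambda>w. w \<in> set (fst s) \<or> list_ex (\<lambda>b. adj es b w) (fst s)) vs, () # snd s))"

text \<open>Distances, cut off at \<open>length (cap X)\<close>, in unary.\<close>

definition udist :: "nat list \<Rightarrow> (nat \<times> nat) list \<Rightarrow> nat list \<Rightarrow> nat \<Rightarrow> nat \<Rightarrow> unit list" where
  "udist vs es X u v = snd (foldl (\<lambda>s _. ball_step vs es v s) ([u], []) (cap X))"

definition profile :: "nat list \<Rightarrow> (nat \<times> nat) list \<Rightarrow> nat list \<Rightarrow> nat \<Rightarrow> unit list list" where
  "profile vs es X w = map (\<lambda>x. udist vs es X w x) X"

text \<open>A slot \<open>(i, l, A)\<close> stands for a vertex of the solution that is still to be chosen from the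
  vertices in \<open>A\<close>; the level \<open>l\<close>, in unary, counts how often \<open>A\<close> has been refined.\<close>

type_synonym slot = "nat \<times> unit list \<times> nat list"

text \<open>Concatenation adds unary numbers. An empty candidate list is excluded because it would
  satisfy the condition vacuously without providing a vertex.\<close>

definition hit :: "nat list \<Rightarrow> (nat \<times> nat) list \<Rightarrow> nat list \<Rightarrow> nat list \<Rightarrow> nat \<times> nat \<Rightarrow> bool" where
  "hit vs es X A p \<longleftrightarrow> \<not> A = [] \<and>
     list_all (\<lambda>w. udist vs es X (fst p) w @ udist vs es X w (snd p) = udist vs es X (fst p) (snd p)) A"

text \<open>On level 0 the profile class is guessed, and \<open>remdups\<close> keeps one choice per
  class rather than one per vertex. On the later levels only the two endpoints of \<open>p\<close>
  can tell candidates apart, so two choices are enough.\<close>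

definition refine ::
  "nat list \<Rightarrow> (nat \<times> nat) list \<Rightarrow> nat list \<Rightarrow> unit list \<Rightarrow> nat list \<Rightarrow> nat \<times> nat \<Rightarrow> nat list list" where
  "refine vs es X l A p =
     (if l = [] then remdups (map (\<lambda>w. filter (\<lambda>w'. profile vs es X w = profile vs es X w') A) A)
      else if l = [()] then
        [filter (\<lambda>w. w = fst p \<or> adj es (fst p) w) A, filter (\<lambda>w. w = snd p \<or> adj es (snd p) w) A]
      else if l = [(), ()] then [filter (\<lambda>w. w = fst p) A, filter (\<lambda>w. w = snd p) A]
      else [])"

definition uncovered ::
  "nat list \<Rightarrow> (nat \<times> nat) list \<Rightarrow> (nat \<times> nat) list \<Rightarrow> nat list \<Rightarrow> slot list \<Rightarrow> (nat \<times> nat) list" where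
  "uncovered vs es ts X s = filter (\<lambda>p. \<not> list_ex (\<lambda>q. hit vs es X (snd (snd q)) p) s) ts"

text \<open>The identifiers single out the one slot to be replaced, as several slots may have the
  same level and candidates.\<close>

definition succs ::
  "nat list \<Rightarrow> (nat \<times> nat) list \<Rightarrow> nat list \<Rightarrow> slot list \<Rightarrow> nat \<times> nat \<Rightarrow> slot list list" where
  "succs vs es X s p = concat (map (\<lambda>q. map (\<lambda>A.
       map (\<lambda>q'. if fst q' = fst q then (fst q, () # fst (snd q), A) else q') s)
     (refine vs es X (fst (snd q)) (snd (snd q)) p)) s)"

text \<open>Finished states are carried along unchanged, so that all branches can be run for the
  same number of rounds.\<close>

definition expand ::
  "nat list \<Rightarrow> (nat \<times> nat) list \<Rightarrow> (nat \<times> nat) list \<Rightarrow> nat list \<Rightarrow> slot list \<Rightarrow> slot list list" where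
  "expand vs es ts X s =
     (case uncovered vs es ts X s of [] \<Rightarrow> [s] | p # _ \<Rightarrow> succs vs es X s p)"

text \<open>Truncated subtraction by list lengths; of \<open>t\<close> only the length matters. In
  Horner's scheme it caps every intermediate result by \<open>vs\<close>, so that the doubling stays
  within the growth condition of \<open>pt_foldl\<close>.\<close>

definition last_part :: "nat list \<Rightarrow> nat list \<Rightarrow> nat list" where
  "last_part vs t = drop (length (drop (length t) vs)) vs"

text \<open>The last \<open>min k (length vs)\<close> elements of \<open>vs\<close>, by Horner's scheme on the binary digits of \<open>k\<close>.\<close>

definition idents :: "nat list \<Rightarrow> nat \<Rightarrow> nat list" where
  "idents vs k =
     foldl (\<lambda>s b. last_part vs (s @ s @ (if b then [0] else []))) [] (rev (bits k))"

type_synonym tms_input = "nat list \<times> (nat \<times> nat) list \<times> (nat \<times> nat) list \<times> nat"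

text \<open>The modulator is recomputed in every round, so that the frontier is the only state of
  the loop.\<close>

definition step :: "tms_input \<Rightarrow> slot list list \<Rightarrow> slot list list" where
  "step I F = (let vs = fst I; es = fst (snd I); ts = fst (snd (snd I)); X = modulator vs es in
     concat (map (expand vs es ts X) F))"

definition start :: "tms_input \<Rightarrow> slot list list" where
  "start I = [map (\<lambda>i. (i, [], fst I)) (idents (fst I) (snd (snd (snd I))))]"

text \<open>A counter: each slot can be refined three times, and each round along a successful
  branch refines one slot.\<close>

definition rounds :: "tms_input \<Rightarrow> nat list" where
  "rounds I = (let is = idents (fst I) (snd (snd (snd I))) in is @ is @ is)"

definition accept :: "tms_input \<Rightarrow> slot list list \<Rightarrow> bool" where
  "accept I F = (let vs = fst I; es = fst (snd I); ts = fst (snd (snd I)); X = modulator vs es in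
     list_ex (\<lambda>s. uncovered vs es ts X s = []) F)"

definition decide :: "tms_input \<Rightarrow> bool" where
  "decide I = accept I (foldl (\<lambda>F _. step I F) (start I) (rounds I))"

section \<open>The components of the algorithm are polynomial\<close>

lemma pt_adj:
  assumes "pt e" "pt a" "pt b" shows "pt (\<lambda>z. adj (e z) (a z) (b z))"
  unfolding adj_def by (intro pt_intros assms)

text \<open>As in the following lemmas, the function is first treated on the tuple of its arguments,
  which loops and maps can then take as their parameter; composition yields the version for
  arbitrary argument terms.\<close>

lemma pt_modulator:
  assumes "pt v" "pt e" shows "pt (\<lambda>z. modulator (v z) (e z))"
proof -
  have "pt (\<lambda>p. modulator (fst p) (snd p))"
    unfolding modulator_def
  proof (rule pt_foldl[where g = "\<lambda>q. 3 * sz q"])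
    show "pt (\<lambda>p. modulator_step (snd (fst p)) (fst (snd p)) (snd (snd p)))"
      unfolding modulator_step_def Let_def by (intro pt_intros pt_adj)
    show "sz (modulator_step (snd a) s x) \<le> sz s + 3 * sz (a, x)"
      for a :: "nat list \<times> (nat \<times> nat) list" and s x
      by (cases x) (simp add: modulator_step_def)
  qed (intro pt_intros pb_intros)+
  from pt_comp[OF this pt_pair[OF assms]] show ?thesis by simp
qed

lemma pt_cap: assumes "pt x" shows "pt (\<lambda>z. cap (x z))"
  unfolding cap_def by (intro pt_intros assms)

lemma pt_udist:
  assumes "pt v" "pt e" "pt x" "pt a" "pt b"
  shows "pt (\<lambda>z. udist (v z) (e z) (x z) (a z) (b z))"
proof -
  have "pt (\<lambda>p. udist (fst p) (fst (snd p)) (fst (snd (snd p))) (fst (snd (snd (snd p)))) (snd (snd (snd (snd p)))))"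
    unfolding udist_def
  \<comment> \<open>The new ball is a filter of \<open>vs\<close> whatever the old one was, and the
    radius grows by one unit.\<close>
  proof (rule pt_snd, rule pt_foldl[where g = "\<lambda>q. sz (fst (fst q)) + 3"])
    show "pt (\<lambda>p. ball_step (fst (fst p)) (fst (snd (fst p))) (snd (snd (snd (snd (fst p))))) (fst (snd p)))"
      unfolding ball_step_def by (intro pt_intros pt_adj)
    fix a :: "nat list \<times> (nat \<times> nat) list \<times> nat list \<times> nat \<times> nat"
      and s and x :: unit
    show "sz (ball_step (fst a) (fst (snd a)) (snd (snd (snd (snd a)))) s) \<le> sz s + (sz (fst (fst (a, x))) + 3)"
      using sz_filter[of _ "fst a"] by (cases s) (simp add: ball_step_def le_SucI trans_le_add2 add.commute)
  qed (intro pt_intros pb_intros pt_sz pt_cap)+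
  from pt_comp[OF this pt_pair[OF assms(1) pt_pair[OF assms(2) pt_pair[OF assms(3) pt_pair[OF assms(4,5)]]]]]
  show ?thesis by simp
qed

lemma pt_profile:
  assumes "pt v" "pt e" "pt x" "pt a" shows "pt (\<lambda>z. profile (v z) (e z) (x z) (a z))"
proof -
  have "pt (\<lambda>p. profile (fst p) (fst (snd p)) (fst (snd (snd p))) (snd (snd (snd p))))"
    unfolding profile_def by (intro pt_intros pt_udist)
  from pt_comp[OF this pt_pair[OF assms(1) pt_pair[OF assms(2) pt_pair[OF assms(3,4)]]]]
  show ?thesis by simp
qed

lemma pt_hit:
  assumes "pt v" "pt e" "pt x" "pt a" "pt b"
  shows "pt (\<lambda>z. hit (v z) (e z) (x z) (a z) (b z))"
proof -
  have "pt (\<lambda>p. hit (fst p) (fst (snd p)) (fst (snd (snd p))) (fst (snd (snd (snd p)))) (snd (snd (snd (snd p)))))"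
    unfolding hit_def by (intro pt_intros pt_udist)
  from pt_comp[OF this pt_pair[OF assms(1) pt_pair[OF assms(2) pt_pair[OF assms(3) pt_pair[OF assms(4,5)]]]]]
  show ?thesis by simp
qed

lemma pt_refine:
  assumes "pt v" "pt e" "pt x" "pt l" "pt a" "pt b"
  shows "pt (\<lambda>z. refine (v z) (e z) (x z) (l z) (a z) (b z))"
proof -
  have "pt (\<lambda>p. refine (fst p) (fst (snd p)) (fst (snd (snd p))) (fst (snd (snd (snd p))))
      (fst (snd (snd (snd (snd p))))) (snd (snd (snd (snd (snd p))))))"
    unfolding refine_def by (intro pt_intros pt_profile pt_adj)
  from pt_comp[OF this pt_pair[OF assms(1) pt_pair[OF assms(2) pt_pair[OF assms(3)
      pt_pair[OF assms(4) pt_pair[OF assms(5,6)]]]]]]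
  show ?thesis by simp
qed

lemma pt_uncovered:
  assumes "pt v" "pt e" "pt t" "pt x" "pt s"
  shows "pt (\<lambda>z. uncovered (v z) (e z) (t z) (x z) (s z))"
proof -
  have "pt (\<lambda>p. uncovered (fst p) (fst (snd p)) (fst (snd (snd p))) (fst (snd (snd (snd p)))) (snd (snd (snd (snd p)))))"
    unfolding uncovered_def by (intro pt_intros pt_hit)
  from pt_comp[OF this pt_pair[OF assms(1) pt_pair[OF assms(2) pt_pair[OF assms(3) pt_pair[OF assms(4,5)]]]]]
  show ?thesis by simp
qed

lemma pt_succs:
  assumes "pt v" "pt e" "pt x" "pt s" "pt b"
  shows "pt (\<lambda>z. succs (v z) (e z) (x z) (s z) (b z))"
proof -
  have "pt (\<lambda>p. succs (fst p) (fst (snd p)) (fst (snd (snd p))) (fst (snd (snd (snd p)))) (snd (snd (snd (snd p)))))"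
    unfolding succs_def by (intro pt_intros pt_refine)
  from pt_comp[OF this pt_pair[OF assms(1) pt_pair[OF assms(2) pt_pair[OF assms(3) pt_pair[OF assms(4,5)]]]]]
  show ?thesis by simp
qed

lemma pt_expand:
  assumes "pt v" "pt e" "pt t" "pt x" "pt s"
  shows "pt (\<lambda>z. expand (v z) (e z) (t z) (x z) (s z))"
proof -
  have "pt (\<lambda>p. expand (fst p) (fst (snd p)) (fst (snd (snd p))) (fst (snd (snd (snd p)))) (snd (snd (snd (snd p)))))"
    unfolding expand_def by (intro pt_intros pt_uncovered pt_succs)
  from pt_comp[OF this pt_pair[OF assms(1) pt_pair[OF assms(2) pt_pair[OF assms(3) pt_pair[OF assms(4,5)]]]]]
  show ?thesis by simp
qed

lemma sz_last_part: "sz (last_part vs t) \<le> sz vs"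
proof -
  have "sz (drop n vs) \<le> sz vs" for n
    by (induction vs arbitrary: n) (auto simp: drop_Cons le_SucI trans_le_add2 split: nat.splits)
  then show ?thesis unfolding last_part_def .
qed

lemma pt_idents: assumes "pt v" "pt k" shows "pt (\<lambda>z. idents (v z) (k z))"
proof -
  have "pt (\<lambda>p. idents (fst p) (snd p))"
    unfolding idents_def
  proof (rule pt_foldl[where g = "\<lambda>q. sz (fst (fst q))"])
    show "pt (\<lambda>p. last_part (fst (fst p)) (fst (snd p) @ fst (snd p) @ (if snd (snd p) then [0] else [])))"
      unfolding last_part_def by (intro pt_intros)
    show "sz (last_part (fst a) (s @ s @ (if x then [0] else []))) \<le> sz s + sz (fst (fst (a, x)))"
      for a :: "nat list \<times> nat" and s x
      using sz_last_part[of "fst a"] by (simp add: trans_le_add2)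
  qed (intro pt_intros pt_bits pb_intros pt_sz)+
  from pt_comp[OF this pt_pair[OF assms]] show ?thesis by simp
qed

lemma pt_step: "pt (\<lambda>p. step (fst p) (snd p))"
  unfolding step_def Let_def by (intro pt_intros pt_expand pt_modulator)

lemma pt_start: "pt start"
  unfolding start_def by (intro pt_intros pt_idents)

lemma pt_rounds: "pt rounds"
  unfolding rounds_def Let_def by (intro pt_intros pt_idents)

lemma pt_accept: "pt (\<lambda>p. accept (fst p) (snd p))"
  unfolding accept_def Let_def by (intro pt_intros pt_uncovered pt_modulator)

section \<open>Correctness\<close>

lemma unit_list_eq_iff: "(xs :: unit list) = ys \<longleftrightarrow> length xs = length ys"
  by (auto simp: list_eq_iff_nth_eq)

lemma last_part_eq: "last_part vs t = drop (length vs - length t) vs"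
  unfolding last_part_def by simp

lemma idents_eq: "idents vs k = drop (length vs - k) vs"
proof (induction k rule: bits.induct)
  case (1 k)
  show ?case
  proof (cases "k = 0")
    case True
    then show ?thesis unfolding idents_def by (subst bits.simps) simp
  next
    case False
    let ?b = "if odd k then [0] else [] :: nat list"
    have "idents vs k = last_part vs (idents vs (k div 2) @ idents vs (k div 2) @ ?b)"
      unfolding idents_def by (subst bits.simps) (use False in simp)
    also have "\<dots> = drop (length vs - k) vs"
    proof -
      \<comment> \<open>Truncating early is harmless: doubling
        \<open>min (length vs) (k div 2)\<close>, adding the digit and truncating again gives
        \<open>min (length vs) k\<close>.\<close>
      have "k = 2 * (k div 2) + length ?b" by simp
      then show ?thesis
        unfolding 1[OF False] last_part_eq length_append length_drop
        by (intro arg_cong[of _ _ "\<lambda>n. drop n vs"]) linarith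
    qed
    finally show ?thesis .
  qed
qed

lemma length_idents: "length (idents vs k) = min (length vs) k"
  unfolding idents_eq by simp

lemma length_cap: "length (cap X) = 3 * length X + 2"
  unfolding cap_def by simp

lemma foldl_invariant:
  assumes "P s" "\<And>s x. x \<in> set xs \<Longrightarrow> P s \<Longrightarrow> P (f s x)" shows "P (foldl f s xs)"
  using assms by (induction xs arbitrary: s) auto

text \<open>Valid for arbitrary arguments, vertices or not; it is used to count the possible
  profiles.\<close>

lemma length_udist_le: "length (udist vs es X u v) \<le> length (cap X)"
proof -
  have "length (snd (foldl (\<lambda>s _. ball_step vs es v s) s c)) \<le> length (snd s) + length c" for s and c :: "unit list"
  proof (induction c arbitrary: s)
    case (Cons a c)
    have "length (snd (ball_step vs es v s)) \<le> Suc (length (snd s))" unfolding ball_step_def by simp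
    then show ?case using Cons[of "ball_step vs es v s"] by simp
  qed simp
  from this[of "([u], [])" "cap X"] show ?thesis unfolding udist_def by simp
qed

text \<open>A solution may have fewer vertices than there are slots; surplus slots repeat a fixed
  vertex \<open>z\<close>.\<close>

lemma exists_onto:
  assumes "finite A" "card S \<le> card A" "S \<noteq> {}" "finite S"
  obtains \<sigma> where "\<sigma> ` A = S"
proof -
  obtain f where f: "f ` S \<subseteq> A" "inj_on f S"
    using card_le_inj[OF assms(4,1,2)] by blast
  obtain z where z: "z \<in> S" using assms by blast
  have "(\<lambda>a. if a \<in> f ` S then inv_into S f a else z) ` A = S"
  proof
    show "S \<subseteq> (\<lambda>a. if a \<in> f ` S then inv_into S f a else z) ` A"
    proof
      fix x assume "x \<in> S"
      then show "x \<in> (\<lambda>a. if a \<in> f ` S then inv_into S f a else z) ` A"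
        using f by (intro image_eqI[of _ _ "f x"]) auto
    qed
  qed (use z inv_into_into[of _ f S] in auto)
  then show ?thesis by (rule that)
qed

lemma length_concat_le:
  assumes "\<And>x. x \<in> set xs \<Longrightarrow> length x \<le> b" shows "length (concat xs) \<le> length xs * b"
  using assms by (induction xs) (auto intro: add_mono)

lemma sum_list_update:
  assumes "distinct (map fst s)" "q \<in> set s" "f r = Suc (f q)"
  shows "sum_list (map f (map (\<lambda>q'. if fst q' = fst q then r else q') s)) = Suc (sum_list (map f s))"
  using assms(1,2)
proof (induction s)
  case (Cons a s)
  show ?case
  proof (cases "a = q")
    case True
    then have "fst q \<notin> fst ` set s" using Cons.prems(1) by simp
    then have "\<forall>q'\<in>set s. fst q' \<noteq> fst q" by (metis image_eqI)
    then have "map (\<lambda>q'. if fst q' = fst q then r else q') s = s" by (intro map_idI) auto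
    then show ?thesis using True assms(3) by simp
  next
    case False
    then have "q \<in> set s" "fst a \<noteq> fst q" using Cons.prems by force+
    then show ?thesis using Cons by simp
  qed
qed simp

text \<open>The progress measure of the search: at most 3 per slot, and increased by each
  refinement.\<close>

definition level :: "slot list \<Rightarrow> nat" where
  "level s = sum_list (map (\<lambda>q. length (fst (snd q))) s)"

locale tms_lists =
  fixes V :: "nat set" and E T :: "nat set set" and vs :: "nat list" and es ts :: "(nat \<times> nat) list"
  assumes graph: "simple_graph V E"
    and terminals: "T \<subseteq> {{u, v} | u v. u \<in> V \<and> v \<in> V}"
    and connected: "\<And>u v. {u, v} \<in> T \<Longrightarrow> gdist V E u v \<noteq> \<infinity>"
    and vs: "distinct vs" "set vs = V"
    and es: "(\<lambda>(u, v). {u, v}) ` set es = E"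
    and ts: "(\<lambda>(u, v). {u, v}) ` set ts = T"
begin

lemma adj_iff: "adj es a b \<longleftrightarrow> {a, b} \<in> E"
proof
  assume "{a, b} \<in> E"
  then obtain u v where "(u, v) \<in> set es" "{a, b} = {u, v}" using es by auto
  then show "adj es a b" unfolding adj_def by (auto simp: doubleton_eq_iff)
qed (use es in \<open>auto simp: adj_def insert_commute\<close>)

lemma finite_V: "finite V"
  using graph unfolding simple_graph_def by blast

section \<open>The greedy modulator\<close>

definition X :: "nat list" where "X = modulator vs es"

definition is_P3 :: "nat \<Rightarrow> nat \<Rightarrow> nat \<Rightarrow> bool" where
  "is_P3 a b c \<longleftrightarrow> {a, b} \<in> E \<and> {b, c} \<in> E \<and> {a, c} \<notin> E \<and> a \<noteq> c"

lemma modulator_step_eq: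
  "modulator_step es Y (a, b, c) =
     (if is_P3 a b c \<and> {a, b, c} \<inter> set Y = {} then a # b # c # Y else Y)"
  unfolding modulator_step_def is_P3_def by (auto simp: adj_iff)

lemma X_subset: "set X \<subseteq> V"
  unfolding X_def modulator_def
proof (rule foldl_invariant[where P = "\<lambda>Y. set Y \<subseteq> V"])
  fix Y t assume *: "t \<in> set (List.product vs (List.product vs vs))" "set Y \<subseteq> V"
  obtain a b c where t: "t = (a, b, c)" by (rule prod_cases3)
  show "set (modulator_step es Y t) \<subseteq> V"
    using * vs unfolding t by (auto simp: modulator_step_eq)
qed simp

text \<open>When the triple is processed, it either meets the current list or is added to it, and
  the list never loses elements.\<close>

lemma X_meets_P3:
  assumes "is_P3 a b c" shows "{a, b, c} \<inter> set X \<noteq> {}"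
proof -
  have "is_P3 a b c \<Longrightarrow> (a, b, c) \<in> set xs \<Longrightarrow> {a, b, c} \<inter> set (foldl (modulator_step es) [] xs) \<noteq> {}"
    for a b c xs
  proof (induction xs rule: rev_induct)
    case (snoc t xs)
    let ?Y = "foldl (modulator_step es) [] xs"
    obtain x y z where t: "t = (x, y, z)" by (cases t)
    show ?case
    proof (cases "(a, b, c) = t")
      case True
      then show ?thesis using snoc.prems by (auto simp: modulator_step_eq)
    next
      case False
      then have "{a, b, c} \<inter> set ?Y \<noteq> {}" using snoc by auto
      moreover have "set ?Y \<subseteq> set (modulator_step es ?Y t)" by (auto simp: t modulator_step_eq)
      ultimately show ?thesis by auto
    qed
  qed simp
  moreover have "(a, b, c) \<in> set (List.product vs (List.product vs vs))"
    using assms graph vs unfolding is_P3_def simple_graph_def by fastforce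
  ultimately show ?thesis using assms unfolding X_def modulator_def by blast
qed

lemma cluster_no_P3:
  assumes "cluster_graph (V - Y) (induced_edges E (V - Y))" "is_P3 a b c"
  shows "{a, b, c} \<inter> Y \<noteq> {}"
proof
  assume disj: "{a, b, c} \<inter> Y = {}"
  obtain P where P: "partition_on (V - Y) P"
    "induced_edges E (V - Y) = {{u, v} | u v. u \<noteq> v \<and> (\<exists>C\<in>P. u \<in> C \<and> v \<in> C)}"
    using assms(1) unfolding cluster_graph_def by blast
  have "a \<in> V" "b \<in> V" "c \<in> V" using assms(2) graph unfolding is_P3_def simple_graph_def by auto
  then have "{a, b} \<in> induced_edges E (V - Y)" "{b, c} \<in> induced_edges E (V - Y)"
    using assms(2) disj unfolding induced_edges_def is_P3_def by auto
  then obtain C D where CD: "C \<in> P" "a \<in> C" "b \<in> C" "D \<in> P" "b \<in> D" "c \<in> D"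
    unfolding P(2) by (auto simp: doubleton_eq_iff)
  then have "C = D" using P(1) unfolding partition_on_def disjoint_def by blast
  then have "{a, c} \<in> induced_edges E (V - Y)"
    unfolding P(2) using CD assms(2) unfolding is_P3_def by blast
  then show False using assms(2) unfolding induced_edges_def is_P3_def by blast
qed

lemma length_X_le:
  assumes "Y \<subseteq> V" "cluster_graph (V - Y) (induced_edges E (V - Y))"
  shows "length X \<le> 3 * card Y"
proof -
  have fin: "finite Y" using assms finite_V finite_subset by blast
  \<comment> \<open>The invariant counts only the part of \<open>Y\<close> already collected: each
    added triple is disjoint from the list and contains a vertex of \<open>Y\<close>, so it
    contributes a new one.\<close>
  have "length X \<le> 3 * card (Y \<inter> set X)"
    unfolding X_def modulator_def
  proof (rule foldl_invariant[where P = "\<lambda>Z. length Z \<le> 3 * card (Y \<inter> set Z)"])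
    fix Z and t :: "nat \<times> nat \<times> nat" assume Z: "length Z \<le> 3 * card (Y \<inter> set Z)"
    obtain a b c where t: "t = (a, b, c)" by (cases t)
    show "length (modulator_step es Z t) \<le> 3 * card (Y \<inter> set (modulator_step es Z t))"
    proof (cases "is_P3 a b c \<and> {a, b, c} \<inter> set Z = {}")
      case True
      then have "{a, b, c} \<inter> Y \<noteq> {}" using cluster_no_P3[OF assms(2), of a b c] by simp
      then obtain y where y: "y \<in> {a, b, c}" "y \<in> Y" by blast
      with True have "y \<notin> set Z" by blast
      have "Suc (card (Y \<inter> set Z)) = card (insert y (Y \<inter> set Z))" using \<open>y \<notin> set Z\<close> by simp
      also have "\<dots> \<le> card (Y \<inter> set (a # b # c # Z))"
        using y fin by (intro card_mono) auto
      finally have "Suc (card (Y \<inter> set Z)) \<le> card (Y \<inter> set (a # b # c # Z))" .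
      moreover have "modulator_step es Z t = a # b # c # Z" using True by (simp add: t modulator_step_eq)
      ultimately show ?thesis using Z by (simp only: list.size(4))
    qed (use Z in \<open>auto simp: t modulator_step_eq\<close>)
  qed simp
  also have "\<dots> \<le> 3 * card Y" using fin by (simp add: card_mono)
  finally show ?thesis .
qed

definition N :: nat where "N = 3 * length X + 2"

lemma modulated: "0 < n \<Longrightarrow> modulated_graph V E n (set X)"
proof unfold_locales
  fix a b c assume *: "{a, b} \<in> E" "{b, c} \<in> E" "a \<noteq> c" "a \<notin> set X" "b \<notin> set X" "c \<notin> set X"
  then have "\<not> is_P3 a b c" using X_meets_P3 by blast
  then show "{a, c} \<in> E" using * unfolding is_P3_def by blast
qed (use graph X_subset in auto)

sublocale modulated_graph V E N "set X"
  by (rule modulated) (simp add: N_def)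

lemma terminal_verts: "(u, v) \<in> set ts \<Longrightarrow> u \<in> V \<and> v \<in> V \<and> {u, v} \<in> T"
  using ts terminals by (fastforce simp: doubleton_eq_iff)

text \<open>\<open>d_bound\<close> speaks only of distances below the cap, so applying it with cap
  \<open>N\<close> would be circular. With cap \<open>Suc L\<close>, where \<open>L\<close> is the
  true distance, it gives \<open>L < N\<close>.\<close>

lemma d_terminal: assumes "{u, v} \<in> T" shows "d u v < N"
proof -
  obtain L where L: "gdist V E u v = enat L" using connected[OF assms] by blast
  interpret L: modulated_graph V E "Suc L" "set X" by (rule modulated) simp
  have "capd V E (Suc L) u v = L" unfolding capd_def by (simp add: L)
  then have "L \<le> 3 * card (set X) + 1" using L.d_bound[of u v] by simp
  then have "L < N" using card_length[of X] unfolding N_def by linarith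
  then show ?thesis unfolding capd_def by (simp add: L)
qed

lemma between_iff:
  assumes "{u, v} \<in> T"
  shows "gdist V E u w + gdist V E w v = gdist V E u v \<longleftrightarrow> between u w v"
proof
  have uv: "gdist V E u v = enat (d u v)" using gdist_capd d_terminal[OF assms] .
  {
    assume "between u w v"
    then have "d u w < N" "d w v < N" "d u w + d w v = d u v"
      using d_terminal[OF assms] unfolding between_def by auto
    then show "gdist V E u w + gdist V E w v = gdist V E u v"
      using uv gdist_capd[of V E N u w] gdist_capd[of V E N w v] by simp
  next
    assume eq: "gdist V E u w + gdist V E w v = gdist V E u v"
    then obtain i j where ij: "gdist V E u w = enat i" "gdist V E w v = enat j"
      using uv by (cases "gdist V E u w"; cases "gdist V E w v") auto
    then have "i + j = d u v" using eq uv by simp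
    moreover from this have "d u w = i" "d w v = j"
      using ij d_terminal[OF assms] unfolding capd_def[of V E N u w] capd_def[of V E N w v] by auto
    ultimately show "between u w v" unfolding between_def by simp
  }
qed

lemma length_udist:
  assumes "u \<in> V" "v \<in> V" shows "length (udist vs es X u v) = d u v"
proof -
  define s where "s c = foldl (\<lambda>s _. ball_step vs es v s) ([u], []) c" for c :: "unit list"
  \<comment> \<open>The last clause says that either \<open>v\<close> is reached or every round so
    far has increased the radius; at the end the latter means that the cap is attained.\<close>
  have inv: "set (fst (s c)) = {w \<in> V. gdist V E u w \<le> enat (length (snd (s c)))}
      \<and> length (snd (s c)) \<le> length c
      \<and> (\<forall>i<length (snd (s c)). \<not> gdist V E u v \<le> enat i)
      \<and> (gdist V E u v \<le> enat (length (snd (s c))) \<or> length (snd (s c)) = length c)" for c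
  proof (induction c rule: rev_induct)
    case Nil
    then show ?case using assms gdist_le_0_iff[of u V E] by (auto simp: s_def zero_enat_def[symmetric])
  next
    case (snoc x c)
    have e: "s (c @ [x]) = ball_step vs es v (s c)" by (simp add: s_def)
    show ?case
    proof (cases "gdist V E u v \<le> enat (length (snd (s c)))")
      case True
      then have "v \<in> set (fst (s c))" using snoc assms by auto
      then show ?thesis using snoc True unfolding e ball_step_def by auto
    next
      case False
      then have v: "v \<notin> set (fst (s c))" using snoc by auto
      have "set (fst (ball_step vs es v (s c)))
          = {w \<in> V. gdist V E u w \<le> enat (length (snd (s c))) \<or>
                    (\<exists>b\<in>V. gdist V E u b \<le> enat (length (snd (s c))) \<and> {b, w} \<in> E)}"
        using snoc v unfolding ball_step_def by (auto simp: vs list_ex_iff adj_iff)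
      also have "\<dots> = {w \<in> V. gdist V E u w \<le> enat (Suc (length (snd (s c))))}"
        unfolding gdist_le_Suc_iff[OF graph] using edge_verts by blast
      finally have "set (fst (ball_step vs es v (s c))) = \<dots>" .
      moreover have "snd (ball_step vs es v (s c)) = () # snd (s c)"
        using v unfolding ball_step_def by simp
      ultimately show ?thesis using snoc False unfolding e by (auto simp: less_Suc_eq)
    qed
  qed
  define n where "n = length (udist vs es X u v)"
  have n: "n = length (snd (s (cap X)))" unfolding n_def udist_def s_def ..
  have *: "n \<le> N" "\<And>i. i < n \<Longrightarrow> \<not> gdist V E u v \<le> enat i" "gdist V E u v \<le> enat n \<or> n = N"
    using inv[of "cap X"] unfolding n length_cap N_def by auto
  have "d u v = n"
  proof (cases "gdist V E u v")
    case (enat m)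
    then have "\<not> m < n" "m \<le> n \<or> n = N" using *(2)[of m] *(3) by auto
    then show ?thesis using *(1) enat unfolding capd_def by (auto simp: min_def)
  next
    case infinity
    then show ?thesis using * unfolding capd_def by simp
  qed
  then show ?thesis unfolding n_def by simp
qed

lemma hit_iff:
  assumes "set A \<subseteq> V" "u \<in> V" "v \<in> V"
  shows "hit vs es X A (u, v) \<longleftrightarrow> A \<noteq> [] \<and> (\<forall>w\<in>set A. between u w v)"
  using assms unfolding hit_def between_def
  by (auto simp: unit_list_eq_iff list_all_iff length_udist subset_iff)

lemma profile_eq_iff:
  assumes "w \<in> V" "w' \<in> V" shows "profile vs es X w = profile vs es X w' \<longleftrightarrow> same_profile w w'"
  using assms X_subset unfolding profile_def same_profile_def
  by (auto simp: unit_list_eq_iff length_udist subset_iff)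

section \<open>The search tree\<close>

definition accepted :: "nat list \<Rightarrow> bool" where
  "accepted is \<longleftrightarrow> list_ex (\<lambda>s. uncovered vs es ts X s = [])
     (foldl (\<lambda>F _. concat (map (expand vs es ts X) F)) [map (\<lambda>i. (i, [], vs)) is] (is @ is @ is))"

lemma decide_eq: "decide (vs, es, ts, k) = accepted (idents vs k)"
  unfolding decide_def accept_def step_def start_def rounds_def accepted_def Let_def X_def by simp

text \<open>The inclusion in \<open>V\<close> serves soundness; the bounds on level and size serve
  the running time.\<close>

definition wf_slot :: "nat \<times> unit list \<times> nat list \<Rightarrow> bool" where
  "wf_slot q \<longleftrightarrow> length (fst (snd q)) \<le> 3 \<and> set (snd (snd q)) \<subseteq> V \<and> sz (snd (snd q)) \<le> sz vs"

definition wf_state :: "nat list \<Rightarrow> slot list \<Rightarrow> bool" where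
  "wf_state is s \<longleftrightarrow> map fst s = is \<and> (\<forall>q\<in>set s. wf_slot q)"

lemma refine_wf:
  assumes "set A \<subseteq> V" "sz A \<le> sz vs" "B \<in> set (refine vs es X l A p)"
  shows "wf_slot (i, () # l, B)"
proof -
  have l: "length l < 3" using assms(3) unfolding refine_def by (auto split: if_splits)
  obtain P where "B = filter P A"
    using assms(3) unfolding refine_def by (auto split: if_splits)
  then show ?thesis unfolding wf_slot_def using l assms sz_filter[of P A] by auto
qed

lemma expand_wf:
  assumes "wf_state is s" "s' \<in> set (expand vs es ts X s)" shows "wf_state is s'"
proof (cases "uncovered vs es ts X s")
  case Nil
  then show ?thesis using assms unfolding expand_def by simp
next
  case (Cons p r)
  then obtain q A where q: "q \<in> set s" "A \<in> set (refine vs es X (fst (snd q)) (snd (snd q)) p)"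
    "s' = map (\<lambda>q'. if fst q' = fst q then (fst q, () # fst (snd q), A) else q') s"
    using assms(2) unfolding expand_def succs_def by auto
  have "wf_slot (fst q, () # fst (snd q), A)"
    using q assms(1) by (intro refine_wf[of "snd (snd q)"]) (auto simp: wf_state_def wf_slot_def)
  then show ?thesis using assms(1) unfolding wf_state_def q(3) by auto
qed

definition frontier :: "nat list \<Rightarrow> nat list \<Rightarrow> slot list list" where
  "frontier is c = foldl (\<lambda>F _. concat (map (expand vs es ts X) F)) [map (\<lambda>i. (i, [], vs)) is] c"

lemma frontier_simps:
  "frontier is [] = [map (\<lambda>i. (i, [], vs)) is]"
  "frontier is (c @ [x]) = concat (map (expand vs es ts X) (frontier is c))"
  unfolding frontier_def by simp_all

lemma frontier_wf: "s \<in> set (frontier is c) \<Longrightarrow> wf_state is s"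
proof (induction c arbitrary: s rule: rev_induct)
  case Nil
  then show ?case using vs unfolding frontier_simps wf_state_def wf_slot_def by (auto simp: o_def)
next
  case (snoc x c)
  then show ?case unfolding frontier_simps using expand_wf by auto
qed

text \<open>A pair is covered only if all candidates of some slot hit it, so any choice of one
  candidate per nonempty slot works; heads are taken.\<close>

lemma sound:
  assumes "wf_state is s" "uncovered vs es ts X s = []"
  obtains S where "S \<subseteq> V" "card S \<le> length is" "\<And>u v. (u, v) \<in> set ts \<Longrightarrow> \<exists>w\<in>S. between u w v"
proof
  define S where "S = (\<lambda>q. hd (snd (snd q))) ` {q \<in> set s. snd (snd q) \<noteq> []}"
  show "S \<subseteq> V" unfolding S_def using assms(1) hd_in_set by (fastforce simp: wf_state_def wf_slot_def)
  have "length s = length is" using assms(1) unfolding wf_state_def by auto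
  moreover have "card S \<le> card {q \<in> set s. snd (snd q) \<noteq> []}" unfolding S_def by (intro card_image_le) simp
  moreover have "\<dots> \<le> card (set s)" by (intro card_mono) auto
  ultimately show "card S \<le> length is" using card_length[of s] by linarith
  fix u v assume uv: "(u, v) \<in> set ts"
  then obtain q where q: "q \<in> set s" "hit vs es X (snd (snd q)) (u, v)"
    using assms(2) unfolding uncovered_def by (auto simp: filter_empty_conv list_ex_iff)
  moreover have "set (snd (snd q)) \<subseteq> V" using assms(1) q by (auto simp: wf_state_def wf_slot_def)
  ultimately have "snd (snd q) \<noteq> []" "\<forall>w\<in>set (snd (snd q)). between u w v"
    using hit_iff terminal_verts[OF uv] by blast+
  then have "between u (hd (snd (snd q))) v" "hd (snd (snd q)) \<in> S"
    unfolding S_def using q(1) by auto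
  then show "\<exists>w\<in>S. between u w v" by blast
qed

text \<open>The vertex \<open>w\<close> of a solution is compatible with a slot if the vertices of the slot are
  those that cannot be told apart from \<open>w\<close> at the respective level.\<close>

definition compatible :: "nat \<Rightarrow> unit list \<Rightarrow> nat list \<Rightarrow> bool" where
  "compatible w l A \<longleftrightarrow> w \<in> V \<and> set A \<subseteq> V \<and> w \<in> set A \<and>
    (l = [] \<and> A = vs
     \<or> l = [()] \<and> set A = {w' \<in> V. same_profile w w'}
     \<or> l = [(), ()] \<and> w \<notin> set X \<and> set A = {w' \<in> V. same_profile w w' \<and> w' \<notin> set X \<and> near w w'}
     \<or> l = [(), (), ()] \<and> set A = {w})"

lemma same_profile_sym: "same_profile w w' \<longleftrightarrow> same_profile w' w"
  unfolding same_profile_def by auto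

text \<open>The program filters by the clique of an endpoint \<open>u\<close>, whereas
  \<open>compatible\<close> speaks of the clique of \<open>w\<close>. The filter cannot let in
  vertices of \<open>X\<close>, as these are alone in their profile classes.\<close>

lemma near_class:
  assumes "u \<notin> set X" "w \<notin> set X" "near u w" "w \<in> V"
  shows "{w' \<in> V. same_profile w w' \<and> near u w'} = {w' \<in> V. same_profile w w' \<and> w' \<notin> set X \<and> near w w'}"
proof -
  have "w' \<notin> set X" if "w' \<in> V" "same_profile w w'" for w'
    using same_profile_modulator[of w' w] that assms same_profile_sym by blast
  moreover have "near u w' \<longleftrightarrow> near w w'" if "w' \<notin> set X" for w'
    using near_trans[of u w w'] near_trans[of w u w'] near_sym[of u w] assms that by blast
  ultimately show ?thesis by blast
qed

text \<open>Some candidate \<open>w'\<close> misses the pair although \<open>w\<close> hits it. By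
  the contrapositives of \<open>between_far\<close> and \<open>between_near\<close>, an endpoint
  then lies in the clique of \<open>w\<close> or equals \<open>w\<close>, and this endpoint
  determines the refinement.\<close>

lemma compatible_refine:
  assumes "compatible w l A" "(u, v) \<in> set ts" "between u w v" "\<not> hit vs es X A (u, v)"
  shows "\<exists>B\<in>set (refine vs es X l A (u, v)). compatible w (() # l) B"
proof -
  have w: "w \<in> V" "w \<in> set A" "set A \<subseteq> V" using assms(1) unfolding compatible_def by auto
  have uv: "u \<in> V" "v \<in> V" "d u v < N" using terminal_verts[OF assms(2)] d_terminal by auto
  obtain w' where w': "w' \<in> set A" "\<not> between u w' v" using assms(4) hit_iff[OF w(3) uv(1,2)] w by auto
  have near: "(w = a \<or> adj es a w) \<longleftrightarrow> near a w" for a w unfolding near_def adj_iff ..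
  consider "l = []" "A = vs" | "l = [()]" "set A = {w' \<in> V. same_profile w w'}"
    | "l = [(), ()]" "w \<notin> set X" "set A = {w' \<in> V. same_profile w w' \<and> w' \<notin> set X \<and> near w w'}"
    | "set A = {w}"
    using assms(1) unfolding compatible_def by blast
  then show ?thesis
  proof cases
    case 1
    let ?B = "filter (\<lambda>w'. profile vs es X w = profile vs es X w') A"
    have "?B \<in> set (refine vs es X l A (u, v))" unfolding refine_def using 1 w by auto
    moreover have "set ?B = {w' \<in> V. same_profile w w'}" using 1 vs profile_eq_iff[OF w(1)] by auto
    then have "compatible w (() # l) ?B" unfolding compatible_def
      using w 1 by (auto simp: same_profile_def)
    ultimately show ?thesis by blast
  next
    case 2
    then have "same_profile w w'" "w' \<in> V" using w' by auto
    then consider a where "a = u \<or> a = v" "a \<notin> set X" "w \<notin> set X" "near a w"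
      using between_far[OF uv w(1), of w'] assms(3) w' by blast
    then show ?thesis
    proof cases
      case (1 a)
      let ?B = "filter (\<lambda>w. w = a \<or> adj es a w) A"
      have "?B \<in> set (refine vs es X l A (u, v))" unfolding refine_def using 1 2 by auto
      moreover have "set ?B = {w' \<in> V. same_profile w w' \<and> near a w'}" using 2 near by auto
      then have B: "set ?B = {w' \<in> V. same_profile w w' \<and> w' \<notin> set X \<and> near w w'}"
        using near_class[OF 1(2,3,4) w(1)] by simp
      have "w \<in> set ?B" unfolding B using 1 w by (simp add: same_profile_def near_def)
      then have "compatible w (() # l) ?B" unfolding compatible_def B using 1 2 w(1) by auto
      ultimately show ?thesis by blast
    qed
  next
    case 3
    then have "same_profile w w'" "w' \<in> V" "w' \<notin> set X" "near w w'" using w' by auto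
    then consider a where "a = u \<or> a = v" "w = a"
      using between_near[OF uv w(1), of w'] assms(3) w' 3 by blast
    then show ?thesis
    proof cases
      case (1 a)
      let ?B = "filter (\<lambda>w. w = a) A"
      have "?B \<in> set (refine vs es X l A (u, v))" unfolding refine_def using 1 3 by auto
      moreover have "compatible w (() # l) ?B" unfolding compatible_def using 1 3 w by auto
      ultimately show ?thesis by blast
    qed
  next
    case 4
    then show ?thesis using w' assms(3) by simp
  qed
qed

text \<open>\<open>\<sigma>\<close> assigns to each identifier the solution vertex that its slot
  approximates.\<close>

definition good :: "(nat \<Rightarrow> nat) \<Rightarrow> nat list \<Rightarrow> slot list \<Rightarrow> bool" where
  "good \<sigma> is s \<longleftrightarrow> map fst s = is \<and> (\<forall>q\<in>set s. compatible (\<sigma> (fst q)) (fst (snd q)) (snd (snd q)))"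

lemma level_le: "good \<sigma> is s \<Longrightarrow> level s \<le> 3 * length is"
proof -
  assume g: "good \<sigma> is s"
  have "length (fst (snd q)) \<le> 3" if "q \<in> set s" for q
    using g that unfolding good_def compatible_def by fastforce
  then have "level s \<le> sum_list (map (\<lambda>_. 3) s)" unfolding level_def by (rule sum_list_mono)
  then show ?thesis using g unfolding good_def by (auto simp: sum_list_triv)
qed

text \<open>The slot to refine is one whose solution vertex hits \<open>p\<close>. The program
  cannot know it, but \<open>succs\<close> tries all slots.\<close>

lemma good_succ:
  assumes "good \<sigma> is s" "distinct is" "uncovered vs es ts X s = p # r"
    and hits: "\<And>u v. (u, v) \<in> set ts \<Longrightarrow> \<exists>i\<in>set is. between u (\<sigma> i) v"
  shows "\<exists>s'\<in>set (expand vs es ts X s). good \<sigma> is s' \<and> level s' = Suc (level s)"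
proof -
  obtain u v where p: "p = (u, v)" by (cases p)
  have "p \<in> set (uncovered vs es ts X s)" using assms(3) by simp
  then have uv: "(u, v) \<in> set ts" and nh: "\<And>q. q \<in> set s \<Longrightarrow> \<not> hit vs es X (snd (snd q)) (u, v)"
    unfolding uncovered_def p by (auto simp: list_ex_iff)
  obtain i where i: "i \<in> set is" "between u (\<sigma> i) v" using hits[OF uv] by blast
  have m: "map fst s = is" using assms(1) unfolding good_def by blast
  then obtain q where q: "q \<in> set s" "fst q = i" using i by auto
  have "compatible (\<sigma> i) (fst (snd q)) (snd (snd q))" using assms(1) q unfolding good_def by blast
  from compatible_refine[OF this uv i(2) nh[OF q(1)]]
  obtain B where B: "B \<in> set (refine vs es X (fst (snd q)) (snd (snd q)) (u, v))"
    "compatible (\<sigma> i) (() # fst (snd q)) B" by blast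
  let ?s = "map (\<lambda>q'. if fst q' = fst q then (fst q, () # fst (snd q), B) else q') s"
  have "?s \<in> set (expand vs es ts X s)"
    unfolding expand_def succs_def assms(3) p using q(1) B(1) by auto
  moreover have "good \<sigma> is ?s" using assms(1) B q unfolding good_def by auto
  moreover have "level ?s = Suc (level s)"
    unfolding level_def using q m assms(2) by (intro sum_list_update) auto
  ultimately show ?thesis by blast
qed

lemma complete:
  assumes "distinct is" "\<sigma> ` set is \<subseteq> V"
    and hits: "\<And>u v. (u, v) \<in> set ts \<Longrightarrow> \<exists>i\<in>set is. between u (\<sigma> i) v"
  shows "accepted is"
proof -
  \<comment> \<open>Some state follows the solution and has either finished or made one refinement
    per round.\<close>
  have "\<exists>s\<in>set (frontier is c). good \<sigma> is s \<and> (uncovered vs es ts X s = [] \<or> length c \<le> level s)" for c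
  proof (induction c rule: rev_induct)
    case Nil
    have "good \<sigma> is (map (\<lambda>i. (i, [], vs)) is)"
      unfolding good_def compatible_def using assms(2) vs by (auto simp: o_def)
    then show ?case unfolding frontier_simps by simp
  next
    case (snoc x c)
    then obtain s where s: "s \<in> set (frontier is c)" "good \<sigma> is s"
      "uncovered vs es ts X s = [] \<or> length c \<le> level s" by blast
    show ?case
    proof (cases "uncovered vs es ts X s")
      case Nil
      then have "s \<in> set (frontier is (c @ [x]))"
        unfolding frontier_simps using s by (auto simp: expand_def intro!: bexI[of _ s])
      then show ?thesis using s Nil by blast
    next
      case (Cons p r)
      obtain s' where s': "s' \<in> set (expand vs es ts X s)" "good \<sigma> is s'" "level s' = Suc (level s)"
        using good_succ[OF s(2) assms(1) Cons hits] by blast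
      then have "s' \<in> set (frontier is (c @ [x]))" unfolding frontier_simps using s by auto
      then show ?thesis using s s' Cons by (intro bexI[of _ s']) auto
    qed
  qed
  from this[of "is @ is @ is"] obtain s where s: "s \<in> set (frontier is (is @ is @ is))" "good \<sigma> is s"
    "uncovered vs es ts X s = [] \<or> 3 * length is \<le> level s" by auto
  \<comment> \<open>All slots are on level 3 otherwise, and a further refinement would exceed
    \<open>level_le\<close>.\<close>
  have "uncovered vs es ts X s = []"
  proof (cases "uncovered vs es ts X s")
    case (Cons p r)
    then obtain s' where "good \<sigma> is s'" "level s' = Suc (level s)"
      using good_succ[OF s(2) assms(1) Cons hits] by blast
    then show ?thesis using level_le[of \<sigma> "is" s'] s Cons by simp
  qed
  then show ?thesis using s(1) unfolding accepted_def frontier_def list_ex_iff by blast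
qed

text \<open>Covers the empty solution, onto which no nonempty set of slots can be mapped.\<close>

lemma accepted_no_terminals: assumes "ts = []" shows "accepted is"
proof -
  have *: "uncovered vs es ts X s = []" for s unfolding uncovered_def assms by simp
  then have "frontier is c = [map (\<lambda>i. (i, [], vs)) is]" for c
    by (induction c rule: rev_induct) (auto simp: frontier_simps expand_def)
  then show ?thesis unfolding accepted_def frontier_def[symmetric] using * by simp
qed

lemma accepted_iff:
  "accepted (idents vs k) \<longleftrightarrow>
    (\<exists>S\<subseteq>V. card S \<le> k \<and> (\<forall>u v. {u, v} \<in> T \<longrightarrow>
       (\<exists>w\<in>S. gdist V E u w + gdist V E w v = gdist V E u v)))"
proof
  assume "accepted (idents vs k)"
  then obtain s where s: "s \<in> set (frontier (idents vs k) (idents vs k @ idents vs k @ idents vs k))"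
    "uncovered vs es ts X s = []"
    unfolding accepted_def frontier_def list_ex_iff by blast
  from sound[OF frontier_wf[OF s(1)] s(2)]
  obtain S where S: "S \<subseteq> V" "card S \<le> length (idents vs k)"
    "\<And>u v. (u, v) \<in> set ts \<Longrightarrow> \<exists>w\<in>S. between u w v" by blast
  show "\<exists>S\<subseteq>V. card S \<le> k \<and> (\<forall>u v. {u, v} \<in> T \<longrightarrow>
       (\<exists>w\<in>S. gdist V E u w + gdist V E w v = gdist V E u v))"
  proof (intro exI[of _ S] conjI allI impI)
    show "card S \<le> k" using S(2) length_idents[of vs k] by simp
    fix u v assume uv: "{u, v} \<in> T"
    then have "(u, v) \<in> set ts \<or> (v, u) \<in> set ts" using ts by (fastforce simp: doubleton_eq_iff)
    then obtain w where "w \<in> S" "between u w v \<or> between v w u" using S(3) by blast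
    moreover have "between v w u \<longleftrightarrow> between u w v"
      using capd_commute[of V E N v w] capd_commute[of V E N w u] capd_commute[of V E N v u]
      unfolding between_def by auto
    ultimately show "\<exists>w\<in>S. gdist V E u w + gdist V E w v = gdist V E u v"
      using between_iff[OF uv] by blast
  qed (fact S)
next
  assume "\<exists>S\<subseteq>V. card S \<le> k \<and> (\<forall>u v. {u, v} \<in> T \<longrightarrow>
       (\<exists>w\<in>S. gdist V E u w + gdist V E w v = gdist V E u v))"
  then obtain S where S: "S \<subseteq> V" "card S \<le> k"
    and "\<And>u v. {u, v} \<in> T \<Longrightarrow> \<exists>w\<in>S. gdist V E u w + gdist V E w v = gdist V E u v" by blast
  then have hits: "\<exists>w\<in>S. between u w v" if "(u, v) \<in> set ts" for u v
    using between_iff terminal_verts[OF that] by blast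
  show "accepted (idents vs k)"
  proof (cases "S = {}")
    case True
    then have "p \<notin> set ts" for p using hits by (cases p) blast
    then have "ts = []" by (cases ts) fastforce+
    then show ?thesis by (rule accepted_no_terminals)
  next
    case False
    have dist: "distinct (idents vs k)" unfolding idents_eq using vs by simp
    have "card V = length vs" using vs distinct_card by metis
    then have "card S \<le> length (idents vs k)"
      using S card_mono[OF finite_V S(1)] unfolding length_idents by simp
    then have "card S \<le> card (set (idents vs k))" using distinct_card[OF dist] by simp
    then obtain \<sigma> where "\<sigma> ` set (idents vs k) = S"
      using exists_onto[of "set (idents vs k)" S] False S finite_V finite_subset by blast
    then show ?thesis using dist hits S by (intro complete[of _ \<sigma>]) auto
  qed
qed

end

section \<open>Running time\<close>

lemma enc_two_pow: "enc (replicate m False @ [True]) = enc_nat (2 ^ m)"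
proof (induction m)
  case 0
  then show ?case by (subst enc_nat.simps) simp
next
  case (Suc m)
  then show ?case by (subst enc_nat.simps) simp
qed

text \<open>The output is exponential in the number of digits, so \<open>pt_foldl\<close> does not
  apply. Some time bound is enough, because \<open>computable\<close> asks only for
  termination.\<close>

lemma rt_unary: "\<exists>\<tau>. rt (\<lambda>n::nat. replicate n ()) \<tau>"
proof -
  define f where "f s b = s @ s @ (if b then [()] else [])" for s b
  have "pt (\<lambda>p::nat \<times> unit list \<times> bool. f (fst (snd p)) (snd (snd p)))"
    unfolding f_def by (intro pt_intros)
  then obtain c where c: "rt (\<lambda>p::nat \<times> unit list \<times> bool. f (fst (snd p)) (snd (snd p))) (\<lambda>p. (sz p + 1) ^ c)"
    by (rule pt_rt)
  have "pt (\<lambda>n::nat. (n, [] :: unit list, rev (bits n)))"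
    by (intro pt_intros pt_bits)
  then obtain d where d: "rt (\<lambda>n::nat. (n, [] :: unit list, rev (bits n))) (\<lambda>p. (sz p + 1) ^ d)"
    by (rule pt_rt)
  have eq: "foldl f [] (rev (bits n)) = replicate n ()" for n
  proof (induction n rule: bits.induct)
    case (1 n)
    show ?case
    proof (cases "n = 0")
      case True
      then show ?thesis by (subst bits.simps) simp
    next
      case False
      then have "foldl f [] (rev (bits n)) = f (replicate (n div 2) ()) (odd n)"
        using 1 by (subst bits.simps) simp
      also have "\<dots> = replicate n ()"
        unfolding f_def unit_list_eq_iff by (auto simp: mult_2[symmetric])
      finally show ?thesis .
    qed
  qed
  have "rt (\<lambda>n. foldl f [] (rev (bits n))) = rt (\<lambda>n. replicate n ())"
    unfolding eq ..
  then show ?thesis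
    using rt_comp[OF rt_foldl[OF c] d, unfolded fst_conv snd_conv] by auto
qed

lemma rt_runs:
  assumes "rt F \<tau>" obtains P where "\<And>a. \<exists>t\<le>\<tau> a. runs P (enc a) (enc (F a)) t"
  using assms unfolding rt_def ev_def runs_def by blast

text \<open>With the least significant digit first, a power of two is a block of zeros followed by a
  one, so no arithmetic is required: nested list products produce a block of length
  \<open>D * (n + 1) ^ 3\<close>.\<close>

lemma computable_two_pow: "computable (\<lambda>n. 2 ^ (D * (n + 1) ^ 3))"
proof -
  define G where "G u = map (\<lambda>_. False) (List.product (List.product (() # u) (List.product (() # u) (() # u)))
     (replicate D ())) @ [True]" for u
  have "pt G" unfolding G_def by (intro pt_intros)
  then obtain c where c: "rt G (\<lambda>u. (sz u + 1) ^ c)" by (rule pt_rt)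
  obtain \<tau> where \<tau>: "rt (\<lambda>n::nat. replicate n ()) \<tau>" using rt_unary by blast
  obtain P where P: "\<And>n. \<exists>t. runs P (enc n) (enc (G (replicate n ()))) t"
    using rt_runs[OF rt_comp[OF c \<tau>]] by metis
  have "G (replicate n ()) = replicate (D * (n + 1) ^ 3) False @ [True]" for n
    unfolding G_def by (simp add: map_replicate_const length_product power3_eq_cube algebra_simps)
  then have "enc (G (replicate n ())) = enc_nat (2 ^ (D * (n + 1) ^ 3))" for n
    by (simp only: enc_two_pow)
  then show ?thesis unfolding computable_def using P by auto
qed

text \<open>Separates the machine model from the combinatorics: all that has to be known about the
  search is a bound on its frontiers. The exponent 5 is the one of
  \<open>frontier_bound\<close>.\<close>

lemma decide_time:
  obtains c \<tau> where "rt decide \<tau>"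
    "\<And>I R. sz I \<le> R \<Longrightarrow>
       (\<And>ys zs. rounds I = ys @ zs \<Longrightarrow> sz (foldl (\<lambda>F _. step I F) (start I) ys) \<le> R ^ 5) \<Longrightarrow>
       \<tau> I \<le> (2 * R + 2) ^ c"
proof -
  let ?st = "\<lambda>p::tms_input \<times> slot list list \<times> nat. step (fst p) (fst (snd p))"
  have "pt ?st"
    using pt_comp[OF pt_step pt_pair[OF pt_fst[OF pt_id] pt_fst[OF pt_snd[OF pt_id]]]] by simp
  then obtain cs where cs: "rt ?st (\<lambda>p. (sz p + 1) ^ cs)" by (rule pt_rt)
  obtain ca where ca: "rt (\<lambda>p. accept (fst p) (snd p)) (\<lambda>p. (sz p + 1) ^ ca)"
    using pt_accept by (rule pt_rt)
  have "pt (\<lambda>I. (I, start I, rounds I))" by (intro pt_pair pt_id pt_start pt_rounds)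
  then obtain c0 where c0: "rt (\<lambda>I. (I, start I, rounds I)) (\<lambda>p. (sz p + 1) ^ c0)" by (rule pt_rt)
  obtain cr where cr: "\<And>I. sz (rounds I) \<le> (sz I + 1) ^ cr"
    using pt_sz[OF pt_rounds] unfolding pb_def by blast
  let ?F = "\<lambda>I ys. foldl (\<lambda>F _. step I F) (start I) ys"
  define \<tau>1 where "\<tau>1 I = (sz I + 1) ^ c0 +
    fold_time (\<lambda>q. (sz (I, q) + 1) ^ cs) (\<lambda>F _. step I F) (start I) (rounds I) + 3" for I
  have 1: "rt (\<lambda>I. ?F I (rounds I)) \<tau>1"
    using rt_comp[OF rt_foldl[OF cs] c0, unfolded fst_conv snd_conv] unfolding \<tau>1_def .
  define \<tau> where "\<tau> I = 3 + \<tau>1 I + 5 + (sz (I, ?F I (rounds I)) + 1) ^ ca + 3" for I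
  have 2: "rt decide \<tau>"
    using rt_comp[OF ca rt_pair[OF rt_id 1], unfolded fst_conv snd_conv]
    unfolding decide_def[abs_def] \<tau>_def .
  define g where "g r = 3 + ((r + 1) ^ c0 +
     ((r + 1) ^ cr + 1) * ((r + r ^ 5 + (r + 1) ^ cr + 3) ^ cs + 30) + 3) + 5 + (r + r ^ 5 + 2) ^ ca + 3" for r :: nat
  \<comment> \<open>Unary lists of length \<open>R\<close> make the calculus of \<open>pb\<close>
    applicable to the numerical function \<open>g\<close>; their size is
    \<open>2 * R + 1\<close>.\<close>
  have "pb (\<lambda>u::unit list. length u)" by (rule pb_mono[OF pb_sz]) (simp add: length_less_sz less_imp_le)
  then have "pb (\<lambda>u::unit list. g (length u))" unfolding g_def by (intro pb_intros)
  then obtain c where c: "\<And>u::unit list. g (length u) \<le> (sz u + 1) ^ c" unfolding pb_def by blast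
  have szu: "sz (replicate n ()) = 2 * n + 1" for n by (induction n) auto
  show ?thesis
  proof (rule that[OF 2])
    fix I R assume R: "sz I \<le> R" and F: "\<And>ys zs. rounds I = ys @ zs \<Longrightarrow> sz (?F I ys) \<le> R ^ 5"
    have rounds: "sz (rounds I) \<le> (R + 1) ^ cr"
      by (rule le_trans[OF cr]) (use R in \<open>auto intro: power_mono\<close>)
    have "fold_time (\<lambda>q. (sz (I, q) + 1) ^ cs) (\<lambda>F _. step I F) (start I) (rounds I)
        \<le> (length (rounds I) + 1) * ((R + R ^ 5 + (R + 1) ^ cr + 3) ^ cs + 30)"
    proof (rule fold_time_le)
      fix ys x zs assume e: "rounds I = ys @ x # zs"
      have "sz x < sz (rounds I)" by (intro sz_mem) (simp add: e)
      then have "sz (I, ?F I ys, x) + 1 \<le> R + R ^ 5 + (R + 1) ^ cr + 3"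
        using F[OF e] R rounds by simp
      then show "(sz (I, ?F I ys, x) + 1) ^ cs \<le> (R + R ^ 5 + (R + 1) ^ cr + 3) ^ cs"
        by (rule power_mono) simp
    qed
    also have "\<dots> \<le> ((R + 1) ^ cr + 1) * ((R + R ^ 5 + (R + 1) ^ cr + 3) ^ cs + 30)"
      using length_less_sz[of "rounds I"] rounds by (intro mult_right_mono) auto
    finally have "\<tau>1 I \<le> (R + 1) ^ c0 + ((R + 1) ^ cr + 1) * ((R + R ^ 5 + (R + 1) ^ cr + 3) ^ cs + 30) + 3"
      unfolding \<tau>1_def using R by (intro add_mono power_mono) auto
    moreover have "(sz (I, ?F I (rounds I)) + 1) ^ ca \<le> (R + R ^ 5 + 2) ^ ca"
      using F[of "rounds I" "[]"] R by (intro power_mono) auto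
    ultimately have "\<tau> I \<le> g R" unfolding \<tau>_def g_def by (intro add_mono) auto
    also have "g R \<le> (2 * R + 2) ^ c"
      using c[of "replicate R ()"] by (simp add: szu)
    finally show "\<tau> I \<le> (2 * R + 2) ^ c" .
  qed
qed

context tms_lists
begin

text \<open>A profile consists of \<open>length X\<close> numbers up to \<open>N\<close>, and by
  \<open>remdups\<close> equal profiles yield one choice. The summand 2 is for the levels that
  branch on the endpoints.\<close>

lemma length_refine:
  assumes "set A \<subseteq> V"
  shows "length (refine vs es X l A p) \<le> (N + 1) ^ length X + 2"
proof -
  let ?U = "(\<lambda>j. replicate j ()) ` {..N}" and ?h = "\<lambda>\<pi>. filter (\<lambda>w'. \<pi> = profile vs es X w') A"
  let ?P = "{\<pi>. set \<pi> \<subseteq> ?U \<and> length \<pi> = length X}"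
  have "profile vs es X w \<in> ?P" for w
  proof -
    have "udist vs es X w x \<in> ?U" for x
      using length_udist_le[of vs es X w x]
      by (intro image_eqI[of _ _ "length (udist vs es X w x)"])
        (auto simp: unit_list_eq_iff length_cap N_def)
    then show ?thesis unfolding profile_def by auto
  qed
  then have "set (map (\<lambda>w. ?h (profile vs es X w)) A) \<subseteq> ?h ` ?P" by auto
  moreover have fin: "finite ?P" by (intro finite_lists_length_eq) simp
  ultimately have "card (set (map (\<lambda>w. ?h (profile vs es X w)) A)) \<le> card ?P"
    using card_mono[of "?h ` ?P"] card_image_le[OF fin, of ?h] by (meson finite_imageI le_trans)
  also have "card ?P = card ?U ^ length X" by (intro card_lists_length_eq) simp
  also have "\<dots> \<le> (N + 1) ^ length X"
    using card_image_le[of "{..N}" "\<lambda>j. replicate j ()"] by (intro power_mono) auto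
  finally have "length (remdups (map (\<lambda>w. ?h (profile vs es X w)) A)) \<le> (N + 1) ^ length X"
    by (simp only: length_remdups_card_conv)
  then show ?thesis unfolding refine_def by auto
qed

lemma length_expand:
  assumes "wf_state is s"
  shows "length (expand vs es ts X s) \<le> length is * ((N + 1) ^ length X + 2) + 1"
proof (cases "uncovered vs es ts X s")
  case (Cons p r)
  have "length s = length is" using assms unfolding wf_state_def by auto
  then have "length (succs vs es X s p) \<le> length is * ((N + 1) ^ length X + 2)"
    unfolding succs_def
    by (intro le_trans[OF length_concat_le[where b = "(N + 1) ^ length X + 2"]])
      (use assms length_refine[where p = p] in \<open>auto simp: wf_state_def wf_slot_def\<close>)
  then show ?thesis unfolding expand_def Cons by simp
qed (simp add: expand_def)

lemma length_frontier:
  "length (frontier is c) \<le> (length is * ((N + 1) ^ length X + 2) + 1) ^ length c"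
proof (induction c rule: rev_induct)
  case (snoc x c)
  let ?b = "length is * ((N + 1) ^ length X + 2) + 1"
  have "length (frontier is (c @ [x])) \<le> length (frontier is c) * ?b"
    unfolding frontier_simps
    by (intro le_trans[OF length_concat_le[where b = ?b]]) (use length_expand frontier_wf in auto)
  also have "\<dots> \<le> ?b ^ length c * ?b" by (rule mult_right_mono[OF snoc]) simp
  finally show ?case by (simp add: mult.commute)
qed (simp add: frontier_simps)

lemma sz_frontier:
  assumes "set is \<subseteq> V" "length is \<le> n" "sz vs \<le> n"
  shows "sz (frontier is c) \<le> 1 + length (frontier is c) * (n * (2 * n + 10) + 2)"
proof -
  have "sz s \<le> n * (2 * n + 10) + 1" if "s \<in> set (frontier is c)" for s
  proof -
    have wf: "wf_state is s" using frontier_wf[OF that] .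
    \<comment> \<open>At most \<open>n\<close> each for the identifier and the candidates, 7 for a
      level of at most three units, and 2 for the two pairs.\<close>
    have "sz q \<le> 2 * n + 9" if q: "q \<in> set s" for q
    proof -
      obtain i l A where e: "q = (i, l, A)" by (cases q)
      have "i \<in> set vs" using wf q assms(1) vs unfolding wf_state_def e by force
      then have "sz i \<le> n" using sz_mem[of i vs] assms(3) by simp
      moreover have "length l \<le> 3" "sz A \<le> n"
        using wf q assms(3) unfolding wf_state_def wf_slot_def e by auto
      moreover have "sz l \<le> 1 + length l * 2" using sz_le_length[of l 1] by simp
      ultimately show ?thesis unfolding e by simp
    qed
    then have "sz s \<le> 1 + length s * (2 * n + 9 + 1)" by (rule sz_le_length)
    also have "length s * (2 * n + 9 + 1) \<le> n * (2 * n + 9 + 1)"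
      using wf assms(2) unfolding wf_state_def by (intro mult_right_mono) auto
    finally show ?thesis by (simp add: ac_simps)
  qed
  then have "sz (frontier is c) \<le> 1 + length (frontier is c) * (n * (2 * n + 10) + 1 + 1)"
    by (rule sz_le_length)
  then show ?thesis by (simp add: ac_simps)
qed

text \<open>\<open>9 * K + 3\<close> bounds \<open>N + 1 = 3 * length X + 3\<close>, and there are
  at most \<open>3 * K\<close> rounds.\<close>

lemma frontier_bound:
  fixes K n :: nat
  defines "W \<equiv> (K * ((9 * K + 3) ^ (3 * K) + 2) + 1) ^ (3 * K)"
  assumes "length X \<le> 3 * K" "length is \<le> K" "length c \<le> 3 * length is"
    and "set is \<subseteq> V" "length is \<le> n" "sz vs \<le> n" "0 < n"
  shows "sz (frontier is c) \<le> (W * (n + 1)) ^ 5"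
proof -
  have "(N + 1) ^ length X \<le> (9 * K + 3) ^ length X"
    using assms(2) unfolding N_def by (intro power_mono) auto
  also have "\<dots> \<le> (9 * K + 3) ^ (3 * K)" using assms(2) by (intro power_increasing) auto
  finally have b: "length is * ((N + 1) ^ length X + 2) + 1 \<le> K * ((9 * K + 3) ^ (3 * K) + 2) + 1"
    using assms(3) by (intro add_mono mult_mono) auto
  have "length (frontier is c) \<le> (K * ((9 * K + 3) ^ (3 * K) + 2) + 1) ^ length c"
    by (rule le_trans[OF length_frontier power_mono[OF b]]) simp
  also have "\<dots> \<le> W" unfolding W_def using assms(3,4) by (intro power_increasing) auto
  finally have W: "length (frontier is c) \<le> W" .
  have W1: "1 \<le> W" unfolding W_def by simp
  have "sz (frontier is c) \<le> 1 + W * (n * (2 * n + 10) + 2)"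
    using sz_frontier[OF assms(5,6,7), of c] mult_le_mono1[OF W] by (meson add_left_mono le_trans)
  also have "\<dots> \<le> W * (n * (2 * n + 10) + 3)" using W1 by (simp add: algebra_simps)
  also have "\<dots> \<le> W ^ 5 * (n + 1) ^ 5"
  proof (rule mult_mono)
    show "W \<le> W ^ 5" using power_increasing[of 1 5 W] W1 by simp
    \<comment> \<open>As \<open>n + 1\<close> is at least 2, the factor 8 is absorbed by three
      further powers of it.\<close>
    have "n * (2 * n + 10) + 3 \<le> 2 ^ 3 * (n + 1)\<^sup>2" by (simp add: power2_eq_square algebra_simps)
    also have "\<dots> \<le> (n + 1) ^ 3 * (n + 1)\<^sup>2"
      using \<open>0 < n\<close> by (intro mult_right_mono power_mono) auto
    also have "\<dots> = (n + 1) ^ 5" by (simp flip: power_add)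
    finally show "n * (2 * n + 10) + 3 \<le> (n + 1) ^ 5" .
  qed auto
  finally show ?thesis by (simp only: power_mult_distrib)
qed

end

text \<open>Brings \<open>W\<close> into the form whose computability is easy to show. The constant
  57 is generous: it only has to make \<open>57 * (K + 1) ^ 3\<close> dominate
  \<open>9 * K ^ 3 + 39 * K ^ 2 + 6 * K\<close> coefficient by coefficient.\<close>

lemma branching_bound: "(K * ((9 * K + 3) ^ (3 * K) + 2) + 1) ^ (3 * K) \<le> 2 ^ (57 * (K + 1) ^ 3)"
proof -
  have k: "K + 1 \<le> 2 ^ K" by (induction K) auto
  have "9 * K + 3 \<le> 2 ^ 4 * (K + 1)" by simp
  also have "\<dots> \<le> 2 ^ 4 * 2 ^ K" using k by (intro mult_left_mono) auto
  finally have "9 * K + 3 \<le> 2 ^ (K + 4)" by (simp add: power_add)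
  then have "(9 * K + 3) ^ (3 * K) \<le> (2 ^ (K + 4)) ^ (3 * K)" by (rule power_mono) simp
  then have 1: "(9 * K + 3) ^ (3 * K) \<le> 2 ^ ((K + 4) * (3 * K))" by (simp add: power_mult)
  have "(9 * K + 3) ^ (3 * K) + 2 \<le> 4 * 2 ^ ((K + 4) * (3 * K))"
    using 1 one_le_power[of "2::nat" "(K + 4) * (3 * K)"] by linarith
  also have "\<dots> = 2 ^ ((K + 4) * (3 * K) + 2)" by (simp add: power_add)
  finally have 2: "(9 * K + 3) ^ (3 * K) + 2 \<le> 2 ^ ((K + 4) * (3 * K) + 2)" .
  have "K * ((9 * K + 3) ^ (3 * K) + 2) + 1 \<le> K * 2 ^ ((K + 4) * (3 * K) + 2) + 1 * 2 ^ ((K + 4) * (3 * K) + 2)"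
    using 2 by (intro add_mono mult_left_mono) auto
  also have "\<dots> = (K + 1) * 2 ^ ((K + 4) * (3 * K) + 2)" by (simp add: algebra_simps)
  also have "\<dots> \<le> 2 ^ K * 2 ^ ((K + 4) * (3 * K) + 2)" by (rule mult_right_mono[OF k]) simp
  finally have "K * ((9 * K + 3) ^ (3 * K) + 2) + 1 \<le> 2 ^ (K + ((K + 4) * (3 * K) + 2))"
    by (simp only: power_add)
  then have "(K * ((9 * K + 3) ^ (3 * K) + 2) + 1) ^ (3 * K) \<le> (2 ^ (K + ((K + 4) * (3 * K) + 2))) ^ (3 * K)"
    by (rule power_mono) simp
  also have "\<dots> = 2 ^ ((K + ((K + 4) * (3 * K) + 2)) * (3 * K))" by (simp only: power_mult)
  also have "\<dots> \<le> 2 ^ (57 * (K + 1) ^ 3)"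
  proof (rule power_increasing)
    have "(K + ((K + 4) * (3 * K) + 2)) * (3 * K) = 9 * K ^ 3 + 39 * K\<^sup>2 + 6 * K" by algebra
    also have "\<dots> \<le> 57 * K ^ 3 + 171 * K\<^sup>2 + 171 * K + 57" by linarith
    also have "\<dots> = 57 * (K + 1) ^ 3" by algebra
    finally show "(K + ((K + 4) * (3 * K) + 2)) * (3 * K) \<le> 57 * (K + 1) ^ 3" .
  qed simp
  finally show ?thesis .
qed

lemma dist_to_cluster_attained:
  "\<exists>Y\<subseteq>V. card Y = dist_to_cluster V E \<and> cluster_graph (V - Y) (induced_edges E (V - Y))"
  if "simple_graph V E"
proof -
  have "cluster_graph (V - V) (induced_edges E (V - V))"
    using that unfolding cluster_graph_def induced_edges_def simple_graph_def
    by (intro exI[of _ "{}"]) (auto simp: partition_on_def)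
  then have "\<exists>q. \<exists>Y\<subseteq>V. card Y = q \<and> cluster_graph (V - Y) (induced_edges E (V - Y))"
    by blast
  then show ?thesis unfolding dist_to_cluster_def by (rule LeastI_ex)
qed

lemma tms_encodesE:
  assumes "tms_encodes I x" "I \<in> tms_instances"
  obtains vs es ts where "tms_lists (verts I) (edges I) (terms I) vs es ts" "x = enc (vs, es, ts, bound I)"
proof -
  have p: "(enc :: nat \<times> nat \<Rightarrow> sexp) = enc_pair"
    by (rule ext) (simp add: enc_prod_def enc_pair_def)
  obtain vs es ts where *: "lists_set vs (verts I)"
     "lists_set (map (\<lambda>(u, v). {u, v}) es) (edges I)"
     "lists_set (map (\<lambda>(u, v). {u, v}) ts) (terms I)"
     "x = CONS (enc_list enc_nat vs) (CONS (enc_list enc_pair es)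
           (CONS (enc_list enc_pair ts) (enc_nat (bound I))))"
    using assms(1) unfolding tms_encodes_def by blast
  show ?thesis
  proof (rule that)
    show "x = enc (vs, es, ts, bound I)"
      unfolding * enc_Pair enc_list' p enc_nat' ..
    show "tms_lists (verts I) (edges I) (terms I) vs es ts"
      using * assms(2) unfolding lists_set_def tms_instances_def tms_lists_def by auto
  qed
qed

theorem theorem2:
  "fpt tms_encodes tms_instances tms_yes
     (\<lambda>I. bound I + dist_to_cluster (verts I) (edges I))"
proof -
  obtain c \<tau> where \<tau>: "rt decide \<tau>"
    "\<And>I R. sz I \<le> R \<Longrightarrow>
       (\<And>ys zs. rounds I = ys @ zs \<Longrightarrow> sz (foldl (\<lambda>F _. step I F) (start I) ys) \<le> R ^ 5) \<Longrightarrow>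
       \<tau> I \<le> (2 * R + 2) ^ c"
    by (rule decide_time) blast
  obtain P where P: "\<And>a. \<exists>t\<le>\<tau> a. runs P (enc a) (enc (decide a)) t"
    using rt_runs[OF \<tau>(1)] by blast
  define f :: "nat \<Rightarrow> nat" where "f K = 2 ^ (57 * c * (K + 1) ^ 3)" for K
  have "\<exists>t. runs P x (enc_bool (tms_yes I)) t \<and>
      t \<le> f (bound I + dist_to_cluster (verts I) (edges I)) * sexp_size x ^ (2 * c)"
    if I: "I \<in> tms_instances" and x: "tms_encodes I x" for I x
  proof -
    obtain vs es ts where L: "tms_lists (verts I) (edges I) (terms I) vs es ts"
      and x: "x = enc (vs, es, ts, bound I)" using tms_encodesE[OF x I] .
    interpret tms_lists "verts I" "edges I" "terms I" vs es ts by (rule L)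
    let ?I = "(vs, es, ts, bound I)" and ?is = "idents vs (bound I)"
    define n where "n = sz ?I"
    define K where "K = bound I + dist_to_cluster (verts I) (edges I)"
    define W where "W = (K * ((9 * K + 3) ^ (3 * K) + 2) + 1) ^ (3 * K)"
    obtain Y where "Y \<subseteq> verts I" "card Y = dist_to_cluster (verts I) (edges I)"
      "cluster_graph (verts I - Y) (induced_edges (edges I) (verts I - Y))"
      using dist_to_cluster_attained[OF graph] by blast
    then have X: "length X \<le> 3 * K" using length_X_le[of Y] unfolding K_def by simp
    have "0 < sz vs" "0 < sz es" "0 < sz ts" "0 < sz (bound I)" by simp_all
    \<comment> \<open>Four components of size at least 1 and three pairs.\<close>
    then have n: "7 \<le> n" "sz vs \<le> n" unfolding n_def sz_simps by linarith+
    have is_le: "length ?is \<le> K" "length ?is \<le> n" "set ?is \<subseteq> verts I"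
      using n length_less_sz[of vs] vs(2) set_drop_subset[of _ vs]
      unfolding length_idents K_def idents_eq by auto
    have W1: "1 \<le> W" unfolding W_def by simp
    have "\<tau> ?I \<le> (2 * (W * (n + 1)) + 2) ^ c"
    proof (rule \<tau>(2))
      show "sz ?I \<le> W * (n + 1)" using W1 unfolding n_def[symmetric] by (simp add: trans_le_add2)
      fix ys zs assume e: "rounds ?I = ys @ zs"
      have "length ys + length zs = 3 * length ?is"
        unfolding length_append[symmetric] e[symmetric] rounds_def Let_def by simp
      then have "sz (frontier ?is ys) \<le> (W * (n + 1)) ^ 5"
        unfolding W_def using X is_le n by (intro frontier_bound) auto
      then show "sz (foldl (\<lambda>F _. step ?I F) (start ?I) ys) \<le> (W * (n + 1)) ^ 5"
        unfolding frontier_def step_def start_def Let_def X_def by simp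
    qed
    \<comment> \<open>Since \<open>n\<close> is at least 7, a second factor \<open>n\<close> absorbs
      the additive constants; this is why the final exponent is \<open>2 * c\<close>.\<close>
    also have "\<dots> \<le> (W * n\<^sup>2) ^ c"
    proof (rule power_mono)
      have "2 * (W * (n + 1)) + 2 \<le> W * (2 * n + 4)" using W1 by (simp add: algebra_simps)
      also have "\<dots> \<le> W * n\<^sup>2"
      proof (rule mult_left_mono)
        have "7 * n \<le> n * n" using n by simp
        then show "2 * n + 4 \<le> n\<^sup>2" using n unfolding power2_eq_square by linarith
      qed simp
      finally show "2 * (W * (n + 1)) + 2 \<le> W * n\<^sup>2" .
    qed simp
    also have "\<dots> = W ^ c * n ^ (2 * c)" by (simp add: power_mult_distrib power_mult)
    also have "\<dots> \<le> f K * n ^ (2 * c)"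
    proof (rule mult_right_mono)
      have "W ^ c \<le> (2 ^ (57 * (K + 1) ^ 3)) ^ c"
        unfolding W_def by (rule power_mono[OF branching_bound]) simp
      also have "\<dots> = f K" unfolding f_def by (simp add: power_mult[symmetric] ac_simps)
      finally show "W ^ c \<le> f K" .
    qed simp
    finally have t: "\<tau> ?I \<le> f K * sexp_size x ^ (2 * c)" unfolding n_def x sz_def .
    have "decide ?I = tms_yes I"
      unfolding decide_eq accepted_iff tms_yes_def ..
    then show ?thesis using P[of ?I] t unfolding x K_def by (auto intro: le_trans)
  qed
  then show ?thesis
    unfolding fpt_def using computable_two_pow[of "57 * c"] unfolding f_def by blast
qed

end
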